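(* Let $I\subseteq\mathbb{R}$ be a nonempty open interval and let $\varphi,f:I\to\mathbb{R}$ be functions such that $\varphi$ is continuous and $Z_f^c\subseteq\overline{\mathrm{conv}}\big((\overline{Z_f})^c\big)$. Then $(\varphi,f)$ satisfies $$\varphi\Big(\frac{x+y}{2}\Big)(f(x)+f(y))=\varphi(x)f(x)+\varphi(y)f(y)\qquad\text{for all }x,y\in I$$ if and only if at least one of the following alternatives holds: (a) there exists an interval $J\subseteq I$ (possibly empty) such that $f(x)=0$ for all $x\in I\setminus J$ and $\varphi$ is constant on $\frac12(J+I)$; (b) there exist constants $a,b,c,d,\gamma\in\mathbb{R}$ with $ad\neq bc$ such that, for all $x\in I$, (1) if $\gamma<0$: $f(x)=a\sin(\sqrt{-\gamma}\,x)+b\cos(\sqrt{-\gamma}\,x)\neq0$ and $\varphi(x)=\dfrac{c\sin(\sqrt{-\gamma}\,x)+d\cos(\sqrt{-\gamma}\,x)}{a\sin(\sqrt{-\gamma}\,x)+b\cos(\sqrt{-\gamma}\,x)}$; (2) if $\gamma=0$: $f(x)=a+bx\neq0$ and $\varphi(x)=\dfrac{c+dx}{a+bx}$; (3) if $\gamma>0$: $f(x)=a\sinh(\sqrt{\gamma}\,x)+b\cosh(\sqrt{\gamma}\,x)\neq0$ and $\varphi(x)=\dfrac{c\sinh(\sqrt{\gamma}\,x)+d\cosh(\sqrt{\gamma}\,x)}{a\sinh(\sqrt{\gamma}\,x)+b\cosh(\sqrt{\gamma}\,x)}$.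
   Context: $Z_f:=\{x\in I\mid f(x)=0\}$. For $S\subseteq I$: $S^c:=I\setminus S$ is the complement in $I$; $\overline{S}$ is the closure of $S$ relative to $I$; $\mathrm{conv}(S)$ is the convex hull of $S$ and $\overline{\mathrm{conv}}(S)$ is its closure relative to $I$. For sets $A,B\subseteq\mathbb{R}$, $A+B:=\{a+b: a\in A,\,b\in B\}$ (empty if $A$ or $B$ is empty) and $\frac12 A:=\{\frac12 a: a\in A\}$. The empty set counts as an interval, and every function is considered constant on the empty set. *)

theory Defs
  imports "HOL-Analysis.Analysis" "HOL-Library.Set_Algebras"
begin

text \<open>
  A function on \<open>I\<close> is represented by a total function on the reals; all notions below and all
  uses of them depend only on its values on \<open>I\<close>. Sums \<open>A + B\<close> of sets are Minkowski sums.
\<close>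

definition zero_set :: "real set \<Rightarrow> (real \<Rightarrow> real) \<Rightarrow> real set"
  where "zero_set I f = {x \<in> I. f x = 0}"

definition rel_closure :: "real set \<Rightarrow> real set \<Rightarrow> real set"
  where "rel_closure I S = (top_of_set I) closure_of S"

end

theory Submission
  imports Defs
begin

text \<open>
  Write \<open>m = (x + y) / 2\<close>. The equation says
  \<open>f x * (\<phi> m - \<phi> x) + f y * (\<phi> m - \<phi> y) = 0\<close>.

  On an open interval \<open>V\<close> on which \<open>f\<close> has no zero, \<open>\<phi>\<close> is either constant or injective
  (\<open>constant_or_injective\<close>). If \<open>\<phi>\<close> took equal values at two points without being constant between
  them, it would have an interior peak or, symmetrically, an interior valley. The leftmost peak \<open>z\<close> is strict on both sides, and the equation
  for the pairs \<open>(z - h, z + h)\<close>, \<open>(z, z + h)\<close> and \<open>(z, z - h)\<close> forces \<open>\<phi>\<close>, on one side of \<open>z\<close>, to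
  decrease under each halving of the distance to \<open>z\<close>, against continuity at \<open>z\<close>.

  If \<open>\<phi>\<close> is injective on \<open>V\<close>, the equation can be solved for \<open>f\<close>, so that \<open>f\<close> is as smooth as \<open>\<phi>\<close>;
  integrating it over \<open>y = 2 u - x\<close> with the midpoint \<open>u\<close> fixed expresses \<open>\<phi>\<close> through antiderivatives
  of \<open>f\<close> and \<open>\<phi> f\<close>, so that \<open>\<phi>\<close> is one degree smoother than \<open>f\<close>. Hence both are smooth. The second and
  fourth derivatives at \<open>t = 0\<close> of
  \<open>\<phi> u * (f (u + t) + f (u - t)) = (\<phi> f) (u + t) + (\<phi> f) (u - t)\<close>
  give \<open>\<phi>'' f + 2 \<phi>' f' = 0\<close> and \<open>f''' f = f' f''\<close>. Therefore \<open>f\<close> and \<open>\<phi> f\<close> solve the same linear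
  equation \<open>g'' = \<gamma> g\<close> (\<open>injective_imp_regular\<close>).

  Let \<open>U\<close> be the complement in \<open>I\<close> of the closure of the zero set. If \<open>\<phi>\<close> is injective on a component
  \<open>V\<close> of \<open>U\<close>, then \<open>f\<close> cannot vanish near a boundary point of \<open>V\<close> in \<open>I\<close>, so \<open>V = I\<close>
  (\<open>injective_component_full\<close>). Otherwise \<open>\<phi>\<close> is constant on every component of \<open>U\<close>. Since
  \<open>\<phi> m = \<phi> x\<close> whenever \<open>x \<in> U\<close> and \<open>f y = 0\<close>, these constants agree, and their common value spreads to
  all midpoints of a point of the closed convex hull of \<open>U\<close> and a point of \<open>I\<close>
  (\<open>locally_constant_imp_degenerate\<close>).
\<close>

section \<open>The functional equation on an interval without zeros\<close>

text \<open>The equation of the theorem, for \<open>x\<close> and \<open>y\<close> ranging over a set \<open>V\<close>.\<close>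
definition mid_eq :: "real set \<Rightarrow> (real \<Rightarrow> real) \<Rightarrow> (real \<Rightarrow> real) \<Rightarrow> bool"
  where "mid_eq V \<phi> f \<longleftrightarrow>
    (\<forall>x\<in>V. \<forall>y\<in>V. \<phi> ((x + y) / 2) * (f x + f y) = \<phi> x * f x + \<phi> y * f y)"

lemma mid_eqD:
  assumes "mid_eq V \<phi> f" "x \<in> V" "y \<in> V"
  shows "f x * (\<phi> ((x + y) / 2) - \<phi> x) + f y * (\<phi> ((x + y) / 2) - \<phi> y) = 0"
  using assms unfolding mid_eq_def by (simp add: algebra_simps)

lemma mid_eq_subset: "mid_eq V \<phi> f \<Longrightarrow> W \<subseteq> V \<Longrightarrow> mid_eq W \<phi> f"
  unfolding mid_eq_def by blast

lemma mid_eq_uminus: "mid_eq V \<phi> f \<Longrightarrow> mid_eq V (\<lambda>x. - \<phi> x) f"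
  unfolding mid_eq_def by (simp add: algebra_simps)

lemma mid_eq_reflect: "mid_eq V \<phi> f \<Longrightarrow> mid_eq (uminus ` V) (\<lambda>x. \<phi> (- x)) (\<lambda>x. f (- x))"
  unfolding mid_eq_def by (auto simp: algebra_simps add_divide_distrib diff_divide_distrib)

lemma midpoint_mem:
  fixes V :: "real set"
  assumes "is_interval V" "x \<in> V" "y \<in> V"
  shows "(x + y) / 2 \<in> V"
proof (cases "x \<le> y")
  case True
  show ?thesis by (rule mem_is_interval_1_I[OF assms]) (use True in auto)
next
  case False
  show ?thesis by (rule mem_is_interval_1_I[OF assms(1,3,2)]) (use False in auto)
qed

lemma interval_nbhd:
  fixes V :: "real set"
  assumes "open V" "x \<in> V"
  obtains e where "e > 0" "{x - e..x + e} \<subseteq> V"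
  using open_contains_cball_eq[OF assms(1)] assms(2) that by (auto simp: cball_eq_atLeastAtMost)

text \<open>If the midpoint shares its value with one end, then also with the other end.\<close>
lemma mid_eq_transfer:
  assumes "mid_eq V \<phi> f" "x \<in> V" "y \<in> V" "f y \<noteq> 0" "\<phi> ((x + y) / 2) = \<phi> x"
  shows "\<phi> y = \<phi> x"
  using mid_eqD[OF assms(1-3)] assms(4,5) by simp

text \<open>The heart of the dichotomy: between two points with the same value, \<open>\<phi>\<close> does not exceed it.\<close>
lemma no_interior_peak:
  assumes eq: "mid_eq V \<phi> f" and iv: "is_interval V" and cont: "continuous_on V \<phi>"
    and nz: "\<And>x. x \<in> V \<Longrightarrow> f x \<noteq> 0"
    and xy: "x \<in> V" "y \<in> V" "\<phi> x = \<phi> y" and t: "x \<le> t" "t \<le> y"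
  shows "\<phi> t \<le> \<phi> x"
proof (rule ccontr)
  assume "\<not> \<phi> t \<le> \<phi> x"
  then have tgt: "\<phi> t > \<phi> x" by simp
  have sub: "{x..y} \<subseteq> V" using mem_is_interval_1_I[OF iv xy(1,2)] by auto
  have cxy: "continuous_on {x..y} \<phi>" using cont sub continuous_on_subset by blast
  obtain w where w: "w \<in> {x..y}" "\<And>s. s \<in> {x..y} \<Longrightarrow> \<phi> s \<le> \<phi> w"
    using continuous_attains_sup[of "{x..y}" \<phi>] cxy t by auto
  \<comment> \<open>\<open>z\<close> below is the leftmost point of \<open>{x..y}\<close> at which the maximum \<open>M\<close> is attained.\<close>
  define M where "M = \<phi> w"
  define L where "L = {s \<in> {x..y}. \<phi> s = M}"
  have "closed L" unfolding L_def
    by (rule continuous_closed_preimage_constant[OF cxy]) simp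
  moreover have "L \<subseteq> {x..y}" by (auto simp: L_def)
  ultimately have "compact L" using compact_Icc[of x y] compact_Int_closed[of "{x..y}" L]
    by (simp add: inf.absorb2)
  moreover have "L \<noteq> {}" using w unfolding L_def M_def by auto
  ultimately obtain z where z: "z \<in> L" "\<And>s. s \<in> L \<Longrightarrow> z \<le> s"
    using compact_attains_inf by metis
  have Mx: "M > \<phi> x" using tgt w(2)[of t] t unfolding M_def by auto
  have zM: "\<phi> z = M" and zi: "x \<le> z" "z \<le> y" using z(1) by (auto simp: L_def)
  have zne: "x < z" "z < y" using zM Mx xy(3) zi by (auto simp: order.order_iff_strict)
  define d where "d = min (z - x) (y - z)"
  have d: "d > 0" using zne by (simp add: d_def)
  have inV: "z + s \<in> V" if "\<bar>s\<bar> \<le> d" for s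
    by (rule subsetD[OF sub]) (use that zi in \<open>auto simp: d_def\<close>)
  have inV': "t \<in> V" if "z < t" "t \<le> z + d" for t using inV[of "t - z"] that by simp
  have left: "\<phi> (z - h) < M" if "0 < h" "h \<le> d" for h
  proof -
    have "z - h \<in> {x..y}" using that zi by (auto simp: d_def)
    moreover have "z - h \<notin> L" using z(2)[of "z - h"] that by auto
    ultimately show ?thesis using w(2)[of "z - h"] by (auto simp: L_def M_def)
  qed
  \<comment> \<open>Were \<open>M\<close> attained at \<open>z + h\<close>, it would also be attained at the reflected point \<open>z - h\<close>.\<close>
  have right: "\<phi> (z + h) < M" if "0 < h" "h \<le> d" for h
  proof -
    have mem: "z + h \<in> V" "z - h \<in> V" using inV[of h] inV[of "- h"] that by auto
    have "\<phi> (z + h) \<noteq> M"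
    proof
      assume "\<phi> (z + h) = M"
      then have "\<phi> (z - h) = \<phi> (z + h)"
        using mid_eq_transfer[OF eq mem nz[OF mem(2)]] zM by simp
      then show False using left[OF that] \<open>\<phi> (z + h) = M\<close> by simp
    qed
    moreover have "\<phi> (z + h) \<le> M" unfolding M_def
      by (rule w(2)) (use that zi in \<open>auto simp: d_def\<close>)
    ultimately show ?thesis by simp
  qed
  \<comment> \<open>For \<open>s = 1\<close> and \<open>s = -1\<close>, \<open>P s h\<close> compares the values at distance \<open>h / 2\<close> and \<open>h\<close> to the right
    and to the left of \<open>z\<close>. As \<open>f (z - h)\<close> and \<open>f (z + h)\<close> have opposite signs, while \<open>f (z + s h) * P s h\<close>
    has the sign of \<open>f z\<close>, the two comparisons have opposite signs.\<close>
  define P where "P s h = \<phi> (z + s * h / 2) - \<phi> (z + s * h)" for s h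
  have opp: "P 1 h * P (-1) h < 0" if h: "0 < h" "h \<le> d" for h
  proof -
    have mem: "z + h \<in> V" "z - h \<in> V" "z \<in> V" using inV[of h] inV[of "- h"] inV[of 0] h by auto
    have e1: "f (z - h) * (M - \<phi> (z - h)) + f (z + h) * (M - \<phi> (z + h)) = 0"
      using mid_eqD[OF eq mem(2,1)] zM by simp
    have e2: "f (z + h) * P 1 h = f z * (M - \<phi> (z + h / 2))"
      using mid_eqD[OF eq mem(3,1)] zM by (simp add: P_def algebra_simps add_divide_distrib)
    have e3: "f (z - h) * P (-1) h = f z * (M - \<phi> (z - h / 2))"
      using mid_eqD[OF eq mem(3,2)] zM
      by (simp add: P_def algebra_simps add_divide_distrib diff_divide_distrib)
    have pos: "M - \<phi> (z - h) > 0" "M - \<phi> (z + h) > 0" "M - \<phi> (z + h / 2) > 0" "M - \<phi> (z - h / 2) > 0"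
      using left[of h] right[of h] left[of "h/2"] right[of "h/2"] h by auto
    have "(f (z - h) * (M - \<phi> (z - h))) * (f (z + h) * (M - \<phi> (z + h))) < 0"
    proof -
      have "f (z - h) * (M - \<phi> (z - h)) = - (f (z + h) * (M - \<phi> (z + h)))" using e1 by simp
      moreover have "f (z + h) * (M - \<phi> (z + h)) \<noteq> 0" using nz[OF mem(1)] pos by simp
      ultimately show ?thesis by (simp add: power2_eq_square[symmetric] del: mult_eq_0_iff)
    qed
    then have "(f (z - h) * f (z + h)) * ((M - \<phi> (z - h)) * (M - \<phi> (z + h))) < 0"
      by (simp add: ac_simps)
    then have a: "f (z - h) * f (z + h) < 0"
      using pos by (metis mult_pos_pos mult_less_0_iff not_less_iff_gr_or_eq)
    have "(f (z + h) * P 1 h) * (f (z - h) * P (-1) h) = (f z)\<^sup>2 * ((M - \<phi> (z + h / 2)) * (M - \<phi> (z - h / 2)))"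
      unfolding e2 e3 by (simp add: power2_eq_square)
    also have "\<dots> > 0" using nz[OF mem(3)] pos by simp
    finally have "(f (z - h) * f (z + h)) * (P 1 h * P (-1) h) > 0" by (simp add: ac_simps)
    then show ?thesis using a by (metis mult_less_0_iff zero_less_mult_iff not_less_iff_gr_or_eq)
  qed
  \<comment> \<open>If \<open>P s\<close> is negative throughout, then \<open>\<phi>\<close> decreases along \<open>z + s d / 2 ^ n\<close>, whose limit is \<open>z\<close>.\<close>
  have notneg: False if s: "s = 1 \<or> s = -1" and neg: "\<And>h. 0 < h \<Longrightarrow> h \<le> d \<Longrightarrow> P s h < 0" for s
  proof -
    have step: "\<phi> (z + s * (d / 2 ^ n)) \<le> \<phi> (z + s * d)" for n
    proof (induction n)
      case (Suc n)
      have "0 < d / 2 ^ n" "d / 2 ^ n \<le> d" using d by (auto simp: divide_simps)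
      from neg[OF this] show ?case using Suc by (simp add: P_def field_simps)
    qed simp
    have "(\<lambda>n. d / 2 ^ n) \<longlonglongrightarrow> 0" by (rule LIMSEQ_divide_realpow_zero) simp
    then have "(\<lambda>n. z + s * (d / 2 ^ n)) \<longlonglongrightarrow> z + s * 0" by (intro tendsto_intros)
    moreover have "z + s * (d / 2 ^ n) \<in> V" for n
      by (rule inV) (use s d in \<open>auto simp: divide_simps abs_mult\<close>)
    moreover have "z \<in> V" using inV[of 0] d by simp
    ultimately have "(\<lambda>n. \<phi> (z + s * (d / 2 ^ n))) \<longlonglongrightarrow> \<phi> z"
      by (intro continuous_on_tendsto_compose[OF cont]) auto
    then have "\<phi> z \<le> \<phi> (z + s * d)" using step LIMSEQ_le_const2 by blast
    moreover have "\<phi> (z + s * d) < M" using s left[of d] right[of d] d by auto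
    ultimately show False using zM by simp
  qed
  have ne: "P 1 h \<noteq> 0" if "0 < h" "h \<le> d" for h using opp[OF that] by auto
  have cP: "continuous_on {0<..d} (P 1)" unfolding P_def
    by (intro continuous_intros continuous_on_compose2[OF cont]) (use inV inV' in auto)
  \<comment> \<open>\<open>P 1\<close> has no zero, so by the intermediate value theorem its sign does not change.\<close>
  have "is_interval (P 1 ` {0<..d})"
    using connected_continuous_image[OF cP] by (simp add: is_interval_connected_1)
  then have same: "P 1 h < 0 \<Longrightarrow> 0 < h \<Longrightarrow> h \<le> d \<Longrightarrow> 0 < k \<Longrightarrow> k \<le> d \<Longrightarrow> P 1 k < 0" for h k
    using mem_is_interval_1_I[of "P 1 ` {0<..d}" "P 1 h" "P 1 k" 0] ne
    by (force simp: not_less)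
  show False
  proof (cases "P 1 d < 0")
    case True
    then show False using notneg[of 1] same[of d] d by auto
  next
    case False
    have "P (-1) h < 0" if "0 < h" "h \<le> d" for h
    proof -
      have "\<not> P 1 h < 0" using same[of h d] that d False by auto
      then show ?thesis using opp[OF that] by (auto simp: mult_less_0_iff)
    qed
    then show False using notneg[of "-1"] by auto
  qed
qed

lemma const_between:
  assumes eq: "mid_eq V \<phi> f" and iv: "is_interval V" and cont: "continuous_on V \<phi>"
    and nz: "\<And>x. x \<in> V \<Longrightarrow> f x \<noteq> 0"
    and xy: "x \<in> V" "y \<in> V" "\<phi> x = \<phi> y" and t: "x \<le> t" "t \<le> y"
  shows "\<phi> t = \<phi> x"
proof (rule antisym)
  show "\<phi> t \<le> \<phi> x" by (rule no_interior_peak[OF assms])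
  have "- \<phi> t \<le> - \<phi> x"
    by (rule no_interior_peak[OF mid_eq_uminus[OF eq] iv _ nz xy(1,2) _ t])
      (auto intro!: continuous_intros cont simp: xy(3))
  then show "\<phi> x \<le> \<phi> t" by simp
qed

text \<open>
  The last point \<open>s\<close> of \<open>{x..w}\<close> with the value \<open>\<phi> x\<close> is \<open>w\<close>: \<open>\<phi>\<close> is constant on \<open>{x..s}\<close>,
  and otherwise reflecting a point of \<open>{x..<s}\<close> at \<open>s\<close> would yield a later one.
\<close>
lemma const_rightwards:
  assumes eq: "mid_eq V \<phi> f" and iv: "is_interval V" and cont: "continuous_on V \<phi>"
    and nz: "\<And>x. x \<in> V \<Longrightarrow> f x \<noteq> 0"
    and xy: "x \<in> V" "y \<in> V" "\<phi> x = \<phi> y" "x < y" and w: "w \<in> V" "x \<le> w"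
  shows "\<phi> w = \<phi> x"
proof (rule ccontr)
  assume ne: "\<phi> w \<noteq> \<phi> x"
  have yw: "y < w" using const_between[OF eq iv cont nz xy(1-3) w(2)] ne by force
  have sub: "{x..w} \<subseteq> V" using mem_is_interval_1_I[OF iv xy(1) w(1)] by auto
  define L where "L = {s \<in> {x..w}. \<phi> s = \<phi> x}"
  have "closed L" unfolding L_def
    by (rule continuous_closed_preimage_constant[OF continuous_on_subset[OF cont sub]]) simp
  moreover have "L \<subseteq> {x..w}" by (auto simp: L_def)
  ultimately have "compact L" using compact_Icc[of x w] compact_Int_closed[of "{x..w}" L]
    by (simp add: inf.absorb2)
  moreover have "y \<in> L" using xy yw by (auto simp: L_def)
  ultimately obtain s where s: "s \<in> L" "\<And>r. r \<in> L \<Longrightarrow> r \<le> s"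
    using compact_attains_sup[of L] by auto
  have sy: "y \<le> s" using s(2) \<open>y \<in> L\<close> by blast
  have ss: "\<phi> s = \<phi> x" "s < w" using s(1) ne by (auto simp: L_def order.order_iff_strict)
  have sV: "s \<in> V" using sub ss sy xy by auto
  define h where "h = min (w - s) (s - x)"
  have h: "h > 0" using ss sy xy by (simp add: h_def)
  have m: "s - h \<in> V" "s + h \<in> V"
    by (rule subsetD[OF sub]; use ss sy xy in \<open>auto simp: h_def min_def\<close>)+
  have "\<phi> (s - h) = \<phi> x"
    by (rule const_between[OF eq iv cont nz xy(1) sV]) (use ss h in \<open>auto simp: h_def\<close>)
  then have "\<phi> (s + h) = \<phi> x"
    using mid_eq_transfer[OF eq m nz[OF m(2)]] ss by simp
  moreover have "s + h \<le> w" "x \<le> s + h" using h sy xy by (auto simp: h_def)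
  ultimately have "s + h \<in> L" by (simp add: L_def)
  then show False using s(2) h by force
qed

lemma constant_or_injective:
  assumes eq: "mid_eq V \<phi> f" and iv: "is_interval V" and cont: "continuous_on V \<phi>"
    and nz: "\<And>x. x \<in> V \<Longrightarrow> f x \<noteq> 0"
  shows "\<phi> constant_on V \<or> inj_on \<phi> V"
proof (rule disjCI)
  assume "\<not> inj_on \<phi> V"
  then obtain x y where xy: "x \<in> V" "y \<in> V" "\<phi> x = \<phi> y" "x < y"
    unfolding inj_on_def by (metis linorder_neqE_linordered_idom)
  have "\<phi> w = \<phi> x" if w: "w \<in> V" for w
  proof (cases "x \<le> w")
    case True
    show ?thesis by (rule const_rightwards[OF assms xy w True])
  next
    case False
    have "\<phi> (- (- w)) = \<phi> (- (- y))"
      by (rule const_rightwards[OF mid_eq_reflect[OF eq], of "- y" "- x" "- w"])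
        (use False xy w iv nz in \<open>auto intro!: continuous_on_compose2[OF cont] continuous_intros\<close>)
    then show ?thesis using xy by simp
  qed
  then show "\<phi> constant_on V" unfolding constant_on_def by blast
qed

section \<open>Functions of class C^k on an open set of reals\<close>

text \<open>
  \<open>Ck n V g\<close> says that \<open>g\<close> is \<open>n\<close> times continuously differentiable at the points of \<open>V\<close>. Derivatives are
  two-sided, so the notion is meant for open \<open>V\<close>.
\<close>
fun Ck :: "nat \<Rightarrow> real set \<Rightarrow> (real \<Rightarrow> real) \<Rightarrow> bool" where
  "Ck 0 V g \<longleftrightarrow> continuous_on V g"
| "Ck (Suc n) V g \<longleftrightarrow> (\<exists>g'. (\<forall>x\<in>V. (g has_real_derivative g' x) (at x)) \<and> Ck n V g')"

lemma Ck_SucI: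
  "(\<And>x. x \<in> V \<Longrightarrow> (g has_real_derivative g' x) (at x)) \<Longrightarrow> Ck n V g' \<Longrightarrow> Ck (Suc n) V g"
  by auto

lemma Ck_SucD: "Ck (Suc n) V g \<Longrightarrow> Ck n V g"
proof (induction n arbitrary: g)
  case 0
  then show ?case by (auto intro!: continuous_at_imp_continuous_on intro: DERIV_isCont)
next
  case (Suc n)
  then obtain g' where "\<forall>x\<in>V. (g has_real_derivative g' x) (at x)" "Ck (Suc n) V g'" by auto
  then show ?case using Suc.IH[of g'] by auto
qed

lemma Ck_subset: "Ck n V g \<Longrightarrow> W \<subseteq> V \<Longrightarrow> Ck n W g"
proof (induction n arbitrary: g)
  case 0
  then show ?case by (auto intro: continuous_on_subset)
next
  case (Suc n)
  then show ?case by fastforce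
qed

lemma Ck_cong:
  assumes "open V" "\<And>x. x \<in> V \<Longrightarrow> g x = h x" "Ck n V g"
  shows "Ck n V h"
proof (cases n)
  case 0
  then show ?thesis using assms continuous_on_cong[of V V g h] by simp
next
  case (Suc k)
  then obtain g' where g': "\<forall>x\<in>V. (g has_real_derivative g' x) (at x)" "Ck k V g'" using assms by auto
  have "(h has_real_derivative g' x) (at x)" if "x \<in> V" for x
    using DERIV_cong_ev[OF refl _ refl, of g h x "g' x"] g'(1) that assms(1,2)
    by (metis (mono_tags, lifting) eventually_nhds)
  then show ?thesis using g' Suc by auto
qed

lemma Ck_local:
  assumes "\<And>x. x \<in> V \<Longrightarrow> \<exists>W. open W \<and> x \<in> W \<and> Ck n W g"
  shows "Ck n V g"
  using assms
proof (induction n arbitrary: g)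
  case 0
  have "isCont g x" if "x \<in> V" for x
    using 0[OF that] by (auto simp: continuous_on_eq_continuous_at)
  then show ?case by (simp add: continuous_at_imp_continuous_on)
next
  case (Suc n)
  have "(g has_real_derivative deriv g x) (at x)" if "x \<in> V" for x
    using Suc.prems[OF that] by (auto dest!: bspec simp: DERIV_imp_deriv)
  moreover have "Ck n V (deriv g)"
  proof (rule Suc.IH)
    fix x assume "x \<in> V"
    from Suc.prems[OF this] obtain W g' where W: "open W" "x \<in> W"
      "\<forall>x\<in>W. (g has_real_derivative g' x) (at x)" "Ck n W g'" by auto
    have "Ck n W (deriv g)" by (rule Ck_cong[OF W(1) _ W(4)]) (use W(3) in \<open>auto simp: DERIV_imp_deriv\<close>)
    then show "\<exists>W. open W \<and> x \<in> W \<and> Ck n W (deriv g)" using W by blast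
  qed
  ultimately show ?case by auto
qed

lemma Ck_const: "Ck n V (\<lambda>x. c)"
proof (induction n arbitrary: c)
  case (Suc n)
  show ?case by (rule Ck_SucI[where g' = "\<lambda>_. 0"]) (auto intro: Suc.IH)
qed simp

lemma Ck_add: "Ck n V g \<Longrightarrow> Ck n V h \<Longrightarrow> Ck n V (\<lambda>x. g x + h x)"
proof (induction n arbitrary: g h)
  case 0
  then show ?case by (auto intro!: continuous_intros)
next
  case (Suc n)
  then obtain g' h' where gh: "\<forall>x\<in>V. (g has_real_derivative g' x) (at x)" "Ck n V g'"
    "\<forall>x\<in>V. (h has_real_derivative h' x) (at x)" "Ck n V h'" by auto
  show ?case by (rule Ck_SucI[where g' = "\<lambda>x. g' x + h' x"])
    (use gh in \<open>auto intro!: Suc.IH derivative_intros\<close>)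
qed

lemma Ck_mult: "Ck n V g \<Longrightarrow> Ck n V h \<Longrightarrow> Ck n V (\<lambda>x. g x * h x)"
proof (induction n arbitrary: g h)
  case 0
  then show ?case by (auto intro!: continuous_intros)
next
  case (Suc n)
  then obtain g' h' where gh: "\<forall>x\<in>V. (g has_real_derivative g' x) (at x)" "Ck n V g'"
    "\<forall>x\<in>V. (h has_real_derivative h' x) (at x)" "Ck n V h'" by auto
  show ?case
  proof (rule Ck_SucI[where g' = "\<lambda>x. g' x * h x + h' x * g x"])
    show "((\<lambda>x. g x * h x) has_real_derivative g' x * h x + h' x * g x) (at x)" if "x \<in> V" for x
      using gh that by (auto intro!: DERIV_mult)
    show "Ck n V (\<lambda>x. g' x * h x + h' x * g x)"
      by (rule Ck_add[OF Suc.IH[OF gh(2) Ck_SucD[OF Suc.prems(2)]] Suc.IH[OF gh(4) Ck_SucD[OF Suc.prems(1)]]])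
  qed
qed

lemma Ck_diff: "Ck n V g \<Longrightarrow> Ck n V h \<Longrightarrow> Ck n V (\<lambda>x. g x - h x)"
  using Ck_add[of n V g "\<lambda>x. (-1) * h x"] Ck_mult[OF Ck_const[of n V "-1"], of h] by simp

lemma Ck_inverse: "Ck n V g \<Longrightarrow> (\<And>x. x \<in> V \<Longrightarrow> g x \<noteq> 0) \<Longrightarrow> Ck n V (\<lambda>x. inverse (g x))"
proof (induction n arbitrary: g)
  case 0
  then show ?case by (auto intro!: continuous_intros)
next
  case (Suc n)
  then obtain g' where g: "\<forall>x\<in>V. (g has_real_derivative g' x) (at x)" "Ck n V g'" by auto
  show ?case
  proof (rule Ck_SucI[where g' = "\<lambda>x. (-1) * (g' x * (inverse (g x) * inverse (g x)))"])
    show "((\<lambda>x. inverse (g x)) has_real_derivative (-1) * (g' x * (inverse (g x) * inverse (g x)))) (at x)"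
      if "x \<in> V" for x
      using DERIV_inverse_fun[of g "g' x" x UNIV] g that Suc.prems(2)[OF that] by (simp add: ac_simps)
    show "Ck n V (\<lambda>x. (-1) * (g' x * (inverse (g x) * inverse (g x))))"
    proof -
      have i: "Ck n V (\<lambda>x. inverse (g x))" by (rule Suc.IH[OF Ck_SucD[OF Suc.prems(1)] Suc.prems(2)])
      show ?thesis by (rule Ck_mult[OF Ck_const Ck_mult[OF g(2) Ck_mult[OF i i]]])
    qed
  qed
qed

lemma Ck_divide:
  "Ck n V g \<Longrightarrow> Ck n V h \<Longrightarrow> (\<And>x. x \<in> V \<Longrightarrow> h x \<noteq> 0) \<Longrightarrow> Ck n V (\<lambda>x. g x / h x)"
  unfolding divide_inverse by (intro Ck_mult Ck_inverse)

lemma Ck_affine: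
  assumes "Ck n V g" "\<And>x. x \<in> W \<Longrightarrow> a * x + b \<in> V"
  shows "Ck n W (\<lambda>x. g (a * x + b))"
  using assms(1)
proof (induction n arbitrary: g)
  case 0
  have "continuous_on W (\<lambda>x. a * x + b)" by (intro continuous_intros)
  then show ?case using 0 assms(2) by (auto intro: continuous_on_compose2)
next
  case (Suc n)
  then obtain g' where g: "\<forall>x\<in>V. (g has_real_derivative g' x) (at x)" "Ck n V g'" by auto
  show ?case
  proof (rule Ck_SucI[where g' = "\<lambda>x. g' (a * x + b) * a"])
    show "((\<lambda>x. g (a * x + b)) has_real_derivative g' (a * x + b) * a) (at x)" if "x \<in> W" for x
      using g(1) assms(2)[OF that] by (auto intro!: DERIV_chain2[of g] derivative_eq_intros)
    show "Ck n W (\<lambda>x. g' (a * x + b) * a)"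
      by (rule Ck_mult[OF Suc.IH[OF g(2)] Ck_const])
  qed
qed

lemma open_interval_antiderivative:
  fixes V :: "real set"
  assumes "open V" "is_interval V" "continuous_on V g"
  obtains G where "\<And>x. x \<in> V \<Longrightarrow> (G has_real_derivative g x) (at x)"
proof (cases "V = {}")
  case True
  then show ?thesis using that by auto
next
  case False
  then obtain x0 where x0: "x0 \<in> V" by auto
  define G where "G = (\<lambda>x. if x0 \<le> x then integral {x0..x} g else - integral {x..x0} g)"
  have "(G has_real_derivative g x) (at x)" if "x \<in> V" for x
  proof -
    obtain e where e: "e > 0" "{x-e..x+e} \<subseteq> V"
      by (rule interval_nbhd[OF assms(1) \<open>x \<in> V\<close>])
    \<comment> \<open>On \<open>{a..b}\<close>, which contains \<open>x0\<close> and a neighbourhood of \<open>x\<close>, \<open>G\<close> is an integral from \<open>a\<close> up to a constant.\<close>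
    define a b where "a = min x0 (x - e)" and "b = max x0 (x + e)"
    have ab: "a \<in> V" "b \<in> V" using e x0 by (auto simp: a_def b_def min_def max_def)
    have sub: "{a..b} \<subseteq> V" using mem_is_interval_1_I[OF assms(2) ab] by auto
    have ca: "continuous_on {a..b} g" using assms(3) sub continuous_on_subset by blast
    have io: "g integrable_on {s..t}" if "a \<le> s" "t \<le> b" for s t
      using integrable_continuous_real[OF continuous_on_subset[OF ca]] that by auto
    have eq: "G y = integral {a..y} g - integral {a..x0} g" if "y \<in> {a..b}" for y
    proof (cases "x0 \<le> y")
      case True
      have "a \<le> x0" by (simp add: a_def)
      then show ?thesis using Henstock_Kurzweil_Integration.integral_combine[of a x0 y g] io[of a y] True that
        by (auto simp: G_def)
    next
      case False
      have "x0 \<le> b" by (simp add: b_def)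
      then show ?thesis using Henstock_Kurzweil_Integration.integral_combine[of a y x0 g] io[of a x0] False that
        by (auto simp: G_def)
    qed
    have xi: "x \<in> {a<..<b}" using e by (auto simp: a_def b_def min_def max_def)
    have "((\<lambda>y. integral {a..y} g) has_real_derivative g x) (at x within {a..b})"
      by (rule integral_has_real_derivative[OF ca]) (use xi in auto)
    then have "((\<lambda>y. integral {a..y} g) has_real_derivative g x) (at x)"
      using xi at_within_interior[of x "{a..b}"] by simp
    then have d: "((\<lambda>y. integral {a..y} g - integral {a..x0} g) has_real_derivative g x) (at x)"
      by (auto intro!: derivative_eq_intros)
    have "\<forall>\<^sub>F y in nhds x. G y = integral {a..y} g - integral {a..x0} g"
      using eventually_nhds_in_open[of "{a<..<b}" x] xi by (auto elim!: eventually_mono intro!: eq)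
    from DERIV_cong_ev[OF refl this refl] d show ?thesis by blast
  qed
  then show ?thesis using that by blast
qed

section \<open>Regularity of solutions with injective \<open>\<phi>\<close>\<close>

lemma Ck_f_of_Ck_phi:
  assumes eq: "mid_eq V \<phi> f" and iv: "is_interval V" and op: "open V"
    and inj: "inj_on \<phi> V" and ck: "Ck n V \<phi>"
  shows "Ck n V f"
proof (rule Ck_local)
  fix x0 assume x0: "x0 \<in> V"
  obtain e where e: "e > 0" "{x0-e..x0+e} \<subseteq> V"
    by (rule interval_nbhd[OF op x0])
  define y where "y = x0 + e"
  have y: "y \<in> V" "y \<noteq> x0" using e by (auto simp: y_def)
  define W where "W = V - {y}"
  have mid: "1 / 2 * x + y / 2 \<in> V" if "x \<in> W" for x
    using midpoint_mem[OF iv, of x y] that y by (simp add: W_def add_divide_distrib)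
  have ne: "\<phi> (1 / 2 * x + y / 2) - \<phi> x \<noteq> 0" if "x \<in> W" for x
  proof
    assume "\<phi> (1 / 2 * x + y / 2) - \<phi> x = 0"
    then have "1 / 2 * x + y / 2 = x" using inj_onD[OF inj _ mid[OF that], of x] that by (simp add: W_def)
    then show False using that by (simp add: W_def)
  qed
  \<comment> \<open>The equation solved for \<open>f x\<close>, with \<open>y \<noteq> x0\<close> kept fixed.\<close>
  have "Ck n W (\<lambda>x. f y * (\<phi> y - \<phi> (1 / 2 * x + y / 2)) / (\<phi> (1 / 2 * x + y / 2) - \<phi> x))"
    by (intro Ck_divide Ck_mult Ck_diff Ck_const Ck_affine[OF ck] mid ne Ck_subset[OF ck])
      (auto simp: W_def)
  then have "Ck n W f"
  proof (rule Ck_cong[rotated 2])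
    show "open W" unfolding W_def using op by auto
    fix x assume x: "x \<in> W"
    then have "f x * (\<phi> ((x + y) / 2) - \<phi> x) + f y * (\<phi> ((x + y) / 2) - \<phi> y) = 0"
      using mid_eqD[OF eq _ y(1)] by (simp add: W_def)
    then show "f y * (\<phi> y - \<phi> (1 / 2 * x + y / 2)) / (\<phi> (1 / 2 * x + y / 2) - \<phi> x) = f x"
      using ne[OF x] by (simp add: divide_eq_eq add_divide_distrib algebra_simps)
  qed
  then show "\<exists>W. open W \<and> x0 \<in> W \<and> Ck n W f"
    using op x0 y by (intro exI[of _ W]) (auto simp: W_def)
qed

text \<open>
  With antiderivatives \<open>G\<close> of \<open>f\<close> and \<open>H\<close> of \<open>\<phi> f\<close>, the equation integrates to
  \<open>\<phi> u * (G (u + h) - G (u - h)) = H (u + h) - H (u - h)\<close>, where \<open>G\<close> and \<open>H\<close> are one degree smoother than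
  \<open>f\<close> and \<open>\<phi>\<close>.
\<close>
lemma Ck_phi_Suc:
  assumes eq: "mid_eq V \<phi> f" and iv: "is_interval V" and op: "open V"
    and nz: "\<And>x. x \<in> V \<Longrightarrow> f x \<noteq> 0" and cf: "Ck n V f" and ck: "Ck n V \<phi>"
  shows "Ck (Suc n) V \<phi>"
proof (rule Ck_local)
  have cont0: "continuous_on V g" if "Ck n V g" for g
    using that by (cases n) (auto intro!: continuous_at_imp_continuous_on intro: DERIV_isCont)
  have cF: "Ck n V (\<lambda>x. \<phi> x * f x)" by (rule Ck_mult[OF ck cf])
  obtain G where G: "\<And>x. x \<in> V \<Longrightarrow> (G has_real_derivative f x) (at x)"
    using open_interval_antiderivative[OF op iv cont0[OF cf]] by blast
  obtain H where H: "\<And>x. x \<in> V \<Longrightarrow> (H has_real_derivative \<phi> x * f x) (at x)"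
    using open_interval_antiderivative[OF op iv cont0[OF cF]] by blast
  have CG: "Ck (Suc n) V G" by (rule Ck_SucI[OF G cf])
  have CH: "Ck (Suc n) V H" by (rule Ck_SucI[OF H cF])
  fix x0 assume x0: "x0 \<in> V"
  obtain h where h: "h > 0" "{x0-h..x0+h} \<subseteq> V"
    by (rule interval_nbhd[OF op x0])
  define W where "W = {u. 1 * u + h \<in> V} \<inter> {u. 1 * u + (-h) \<in> V}"
  have "open ((\<lambda>u. 1 * u + h) -` V \<inter> (\<lambda>u. 1 * u + (-h)) -` V)"
    by (intro open_Int open_vimage op continuous_intros)
  then have oW: "open W" by (simp add: W_def vimage_def)
  have memV: "u + t \<in> V" if "u \<in> W" "\<bar>t\<bar> \<le> h" for u t
    by (rule mem_is_interval_1_I[OF iv, of "u - h" "u + h"]) (use that in \<open>auto simp: W_def\<close>)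
  have Gne: "G (1 * u + h) - G (1 * u + (-h)) \<noteq> 0" if u: "u \<in> W" for u
  proof
    assume "G (1 * u + h) - G (1 * u + (-h)) = 0"
    moreover have "\<exists>z. u - h < z \<and> z < u + h \<and> G (u + h) - G (u - h) = (u + h - (u - h)) * f z"
    proof (rule MVT2)
      show "u - h < u + h" using h by simp
      fix x assume "u - h \<le> x" "x \<le> u + h"
      then show "(G has_real_derivative f x) (at x)" using memV[OF u, of "x - u"] G by (auto simp: abs_le_iff)
    qed
    ultimately obtain z where "u - h < z" "z < u + h" "f z = 0" using h by auto
    then show False using nz[of z] memV[OF u, of "z - u"] by (auto simp: abs_le_iff)
  qed
  have "Ck (Suc n) W (\<lambda>u. (H (1 * u + h) - H (1 * u + (-h))) / (G (1 * u + h) - G (1 * u + (-h))))"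
    by (intro Ck_divide Ck_diff Ck_affine[OF CG] Ck_affine[OF CH] Gne) (auto simp: W_def)
  then have "Ck (Suc n) W \<phi>"
  proof (rule Ck_cong[rotated 2])
    show "open W" by (rule oW)
    fix u assume u: "u \<in> W"
    \<comment> \<open>\<open>D\<close> vanishes at \<open>0\<close>, and the equation makes its derivative zero.\<close>
    define D where "D t = \<phi> u * (G (u + t) - G (u - t)) - (H (u + t) - H (u - t))" for t
    have "(D has_real_derivative 0) (at t)" if "0 \<le> t" "t \<le> h" for t
    proof -
      have m: "u + t \<in> V" "u - t \<in> V" using memV[OF u, of t] memV[OF u, of "-t"] that by auto
      have "\<phi> u * (f (u + t) + f (u - t)) - (\<phi> (u + t) * f (u + t) + \<phi> (u - t) * f (u - t)) = 0"
        using eq m unfolding mid_eq_def by force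
      moreover have "(D has_real_derivative \<phi> u * (f (u + t) - f (u - t) * (-1)) -
          (\<phi> (u + t) * f (u + t) * 1 - \<phi> (u - t) * f (u - t) * (-1))) (at t)"
        unfolding D_def
        by (auto intro!: derivative_eq_intros DERIV_chain2[OF G] DERIV_chain2[OF H] m)
      ultimately show ?thesis by simp
    qed
    moreover from this have "isCont D t" if "0 \<le> t" "t \<le> h" for t
      using that DERIV_isCont by blast
    ultimately have "D h = D 0"
      using h by (intro DERIV_isconst_end[of 0 h D]) (auto intro!: continuous_at_imp_continuous_on)
    then show "(H (1 * u + h) - H (1 * u + (-h))) / (G (1 * u + h) - G (1 * u + (-h))) = \<phi> u"
      using Gne[OF u] by (simp add: D_def divide_eq_eq)
  qed
  moreover have "x0 \<in> W" using h by (auto simp: W_def)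
  ultimately show "\<exists>W. open W \<and> x0 \<in> W \<and> Ck (Suc n) W \<phi>" using oW by blast
qed

lemma Ck_solution:
  assumes eq: "mid_eq V \<phi> f" and iv: "is_interval V" and op: "open V"
    and nz: "\<And>x. x \<in> V \<Longrightarrow> f x \<noteq> 0" and inj: "inj_on \<phi> V" and cont: "continuous_on V \<phi>"
  shows "Ck n V \<phi> \<and> Ck n V f"
proof (induction n)
  case 0
  have "Ck 0 V \<phi>" using cont by simp
  then show ?case using Ck_f_of_Ck_phi[OF eq iv op inj] by blast
next
  case (Suc n)
  then have "Ck (Suc n) V \<phi>" using Ck_phi_Suc[OF eq iv op nz] by blast
  then show ?case using Ck_f_of_Ck_phi[OF eq iv op inj] by blast
qed

section \<open>The differential equation\<close>

text \<open>Differentiating an identity between even (\<open>s = 1\<close>) or odd (\<open>s = -1\<close>) parts at \<open>u\<close> swaps the parity.\<close>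
lemma symmetric_derivative:
  assumes d: "d > 0"
    and p: "\<And>t. \<bar>t\<bar> < d \<Longrightarrow> (p has_real_derivative p' (u + t)) (at (u + t))"
    and q: "\<And>t. \<bar>t\<bar> < d \<Longrightarrow> (q has_real_derivative q' (u + t)) (at (u + t))"
    and eq: "\<And>t. \<bar>t\<bar> < d \<Longrightarrow> a * (p (u + t) + s * p (u - t)) = q (u + t) + s * q (u - t)"
    and t: "\<bar>t\<bar> < d"
  shows "a * (p' (u + t) + (-s) * p' (u - t)) = q' (u + t) + (-s) * q' (u - t)"
proof -
  define D where "D t = a * (p (u + t) + s * p (u - t)) - (q (u + t) + s * q (u - t))" for t
  have m: "(p has_real_derivative p' (u - t)) (at (u - t))" "(q has_real_derivative q' (u - t)) (at (u - t))"
      "(p has_real_derivative p' (u + t)) (at (u + t))" "(q has_real_derivative q' (u + t)) (at (u + t))"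
    using p[of "-t"] q[of "-t"] p[OF t] q[OF t] t by auto
  have c: "((\<lambda>t. p (u - t)) has_real_derivative p' (u - t) * (-1)) (at t)"
      "((\<lambda>t. q (u - t)) has_real_derivative q' (u - t) * (-1)) (at t)"
      "((\<lambda>t. p (u + t)) has_real_derivative p' (u + t) * 1) (at t)"
      "((\<lambda>t. q (u + t)) has_real_derivative q' (u + t) * 1) (at t)"
    by (rule DERIV_chain2[of p] DERIV_chain2[of q], rule m, (auto intro!: derivative_eq_intros)[1])+
  have "(D has_real_derivative a * (p' (u + t) + (-s) * p' (u - t)) - (q' (u + t) + (-s) * q' (u - t))) (at t)"
    unfolding D_def
    by (rule derivative_eq_intros c refl)+ (simp add: algebra_simps)
  moreover have "(D has_real_derivative 0) (at t)"
  proof -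
    have "\<forall>\<^sub>F r in nhds t. D r = 0"
      using eventually_nhds_in_open[of "{-d<..<d}" t] t eq
      by (auto elim!: eventually_mono simp: D_def abs_less_iff)
    from DERIV_cong_ev[OF refl this refl] show ?thesis by simp
  qed
  ultimately show ?thesis using DERIV_unique by fastforce
qed

text \<open>
  A fundamental system \<open>basis1 \<gamma>\<close>, \<open>basis2 \<gamma>\<close> of \<open>g'' = \<gamma> g\<close>: sine and cosine, \<open>1\<close> and \<open>x\<close>, or hyperbolic sine and
  cosine, in the order in which the coefficients appear in the theorem.
\<close>
definition basis1 :: "real \<Rightarrow> real \<Rightarrow> real"
  where "basis1 \<gamma> x = (if \<gamma> < 0 then sin (sqrt (- \<gamma>) * x) else if \<gamma> = 0 then 1 else sinh (sqrt \<gamma> * x))"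

text \<open>The second member of the fundamental system.\<close>
definition basis2 :: "real \<Rightarrow> real \<Rightarrow> real"
  where "basis2 \<gamma> x = (if \<gamma> < 0 then cos (sqrt (- \<gamma>) * x) else if \<gamma> = 0 then x else cosh (sqrt \<gamma> * x))"

lemma const_of_zero_deriv:
  fixes V :: "real set"
  assumes "is_interval V" "\<And>x. x \<in> V \<Longrightarrow> (g has_real_derivative 0) (at x)"
  obtains c where "\<And>x. x \<in> V \<Longrightarrow> g x = c"
  using has_field_derivative_zero_constant[of V g] assms is_interval_convex
  by (metis has_field_derivative_at_within)

text \<open>
  The coefficients of \<open>g\<close> are recovered from \<open>g\<close> and \<open>g'\<close> by Cramer's rule; they have derivative zero.
\<close>
lemma ode_solution:
  assumes iv: "is_interval V"
    and g: "\<And>x. x \<in> V \<Longrightarrow> (g has_real_derivative g' x) (at x)"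
    and g': "\<And>x. x \<in> V \<Longrightarrow> (g' has_real_derivative \<gamma> * g x) (at x)"
  obtains a b where "\<And>x. x \<in> V \<Longrightarrow> g x = a * basis1 \<gamma> x + b * basis2 \<gamma> x"
proof -
  consider "\<gamma> < 0" | "\<gamma> = 0" | "\<gamma> > 0" by linarith
  then show ?thesis
  proof cases
    case 1
    define w where "w = sqrt (- \<gamma>)"
    have w: "w \<noteq> 0" "\<gamma> = - (w * w)" using 1 by (auto simp: w_def)
    obtain a where a: "\<And>x. x \<in> V \<Longrightarrow> g x * sin (w * x) + g' x / w * cos (w * x) = a"
      by (rule const_of_zero_deriv[OF iv, of "\<lambda>x. g x * sin (w * x) + g' x / w * cos (w * x)"])
        (use w in \<open>auto intro!: derivative_eq_intros g g' simp: field_simps\<close>)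
    obtain b where b: "\<And>x. x \<in> V \<Longrightarrow> g x * cos (w * x) - g' x / w * sin (w * x) = b"
      by (rule const_of_zero_deriv[OF iv, of "\<lambda>x. g x * cos (w * x) - g' x / w * sin (w * x)"])
        (use w in \<open>auto intro!: derivative_eq_intros g g' simp: field_simps\<close>)
    have "g x = a * basis1 \<gamma> x + b * basis2 \<gamma> x" if "x \<in> V" for x
    proof -
      have "a * sin (w * x) + b * cos (w * x) = g x * ((sin (w * x))\<^sup>2 + (cos (w * x))\<^sup>2)"
        unfolding a[OF that, symmetric] b[OF that, symmetric] by algebra
      then show ?thesis using 1 by (simp add: basis1_def basis2_def w_def)
    qed
    then show ?thesis by (rule that)
  next
    case 2
    obtain b where b: "\<And>x. x \<in> V \<Longrightarrow> g' x = b"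
      by (rule const_of_zero_deriv[OF iv, of g']) (use g' 2 in auto)
    obtain a where a: "\<And>x. x \<in> V \<Longrightarrow> g x - b * x = a"
      by (rule const_of_zero_deriv[OF iv, of "\<lambda>x. g x - b * x"])
        (auto intro!: derivative_eq_intros g simp: b)
    have "g x = a * basis1 \<gamma> x + b * basis2 \<gamma> x" if "x \<in> V" for x
      using a[OF that] 2 by (simp add: basis1_def basis2_def)
    then show ?thesis by (rule that)
  next
    case 3
    define w where "w = sqrt \<gamma>"
    have w: "w \<noteq> 0" "\<gamma> = w * w" using 3 by (auto simp: w_def)
    obtain a where a: "\<And>x. x \<in> V \<Longrightarrow> g' x / w * cosh (w * x) - g x * sinh (w * x) = a"
      by (rule const_of_zero_deriv[OF iv, of "\<lambda>x. g' x / w * cosh (w * x) - g x * sinh (w * x)"])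
        (use w in \<open>auto intro!: derivative_eq_intros g g' simp: field_simps\<close>)
    obtain b where b: "\<And>x. x \<in> V \<Longrightarrow> g x * cosh (w * x) - g' x / w * sinh (w * x) = b"
      by (rule const_of_zero_deriv[OF iv, of "\<lambda>x. g x * cosh (w * x) - g' x / w * sinh (w * x)"])
        (use w in \<open>auto intro!: derivative_eq_intros g g' simp: field_simps\<close>)
    have "g x = a * basis1 \<gamma> x + b * basis2 \<gamma> x" if "x \<in> V" for x
    proof -
      have "a * sinh (w * x) + b * cosh (w * x) = g x * ((cosh (w * x))\<^sup>2 - (sinh (w * x))\<^sup>2)"
        unfolding a[OF that, symmetric] b[OF that, symmetric] by algebra
      then show ?thesis using 3 by (simp add: basis1_def basis2_def w_def cosh_square_eq)
    qed
    then show ?thesis by (rule that)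
  qed
qed

text \<open>
  The regular solutions: for some \<open>\<gamma>\<close>, both \<open>f\<close> and \<open>\<phi> f\<close> are combinations of the fundamental system of
  \<open>g'' = \<gamma> g\<close> with linearly independent coefficient vectors, and \<open>f\<close> has no zero.
\<close>
definition regular_pair :: "real set \<Rightarrow> (real \<Rightarrow> real) \<Rightarrow> (real \<Rightarrow> real) \<Rightarrow> bool"
  where "regular_pair V \<phi> f \<longleftrightarrow> (\<exists>a b c d \<gamma>. a * d \<noteq> b * c \<and>
    (\<forall>x\<in>V. f x = a * basis1 \<gamma> x + b * basis2 \<gamma> x \<and> f x \<noteq> 0 \<and>
       \<phi> x = (c * basis1 \<gamma> x + d * basis2 \<gamma> x) / (a * basis1 \<gamma> x + b * basis2 \<gamma> x)))"

lemma Ck_four_derivatives: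
  assumes "Ck (Suc (Suc (Suc (Suc 0)))) V g"
  obtains g1 g2 g3 g4 where
    "\<And>x. x \<in> V \<Longrightarrow> (g has_real_derivative g1 x) (at x)"
    "\<And>x. x \<in> V \<Longrightarrow> (g1 has_real_derivative g2 x) (at x)"
    "\<And>x. x \<in> V \<Longrightarrow> (g2 has_real_derivative g3 x) (at x)"
    "\<And>x. x \<in> V \<Longrightarrow> (g3 has_real_derivative g4 x) (at x)"
proof -
  obtain g1 where 1: "\<forall>x\<in>V. (g has_real_derivative g1 x) (at x)" "Ck (Suc (Suc (Suc 0))) V g1"
    using assms by (subst (asm) Ck.simps) blast
  obtain g2 where 2: "\<forall>x\<in>V. (g1 has_real_derivative g2 x) (at x)" "Ck (Suc (Suc 0)) V g2"
    using 1(2) by (subst (asm) Ck.simps) blast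
  obtain g3 where 3: "\<forall>x\<in>V. (g2 has_real_derivative g3 x) (at x)" "Ck (Suc 0) V g3"
    using 2(2) by (subst (asm) Ck.simps) blast
  obtain g4 where 4: "\<forall>x\<in>V. (g3 has_real_derivative g4 x) (at x)"
    using 3(2) by (subst (asm) Ck.simps) blast
  show ?thesis using that[of g1 g2 g3 g4] 1(1) 2(1) 3(1) 4 by blast
qed

lemma injective_imp_regular:
  assumes eq: "mid_eq V \<phi> f" and iv: "is_interval V" and op: "open V" and ne: "V \<noteq> {}"
    and nz: "\<And>x. x \<in> V \<Longrightarrow> f x \<noteq> 0" and inj: "inj_on \<phi> V" and cont: "continuous_on V \<phi>"
  shows "regular_pair V \<phi> f"
proof -
  have c4: "Ck (Suc (Suc (Suc (Suc 0)))) V \<phi>" "Ck (Suc (Suc (Suc (Suc 0)))) V f"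
    using Ck_solution[OF eq iv op nz inj cont] by blast+
  obtain \<phi>1 \<phi>2 \<phi>3 \<phi>4 where D\<phi>:
       "\<And>x. x \<in> V \<Longrightarrow> (\<phi> has_real_derivative \<phi>1 x) (at x)"
       "\<And>x. x \<in> V \<Longrightarrow> (\<phi>1 has_real_derivative \<phi>2 x) (at x)"
       "\<And>x. x \<in> V \<Longrightarrow> (\<phi>2 has_real_derivative \<phi>3 x) (at x)"
       "\<And>x. x \<in> V \<Longrightarrow> (\<phi>3 has_real_derivative \<phi>4 x) (at x)"
    using Ck_four_derivatives[OF c4(1)] by blast
  obtain f1 f2 f3 f4 where Df:
       "\<And>x. x \<in> V \<Longrightarrow> (f has_real_derivative f1 x) (at x)"
       "\<And>x. x \<in> V \<Longrightarrow> (f1 has_real_derivative f2 x) (at x)"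
       "\<And>x. x \<in> V \<Longrightarrow> (f2 has_real_derivative f3 x) (at x)"
       "\<And>x. x \<in> V \<Longrightarrow> (f3 has_real_derivative f4 x) (at x)"
    using Ck_four_derivatives[OF c4(2)] by blast
  note D = D\<phi> Df
  define F where "F x = \<phi> x * f x" for x
  define F1 where "F1 x = \<phi>1 x * f x + \<phi> x * f1 x" for x
  define F2 where "F2 x = \<phi>2 x * f x + 2 * \<phi>1 x * f1 x + \<phi> x * f2 x" for x
  define F3 where "F3 x = \<phi>3 x * f x + 3 * \<phi>2 x * f1 x + 3 * \<phi>1 x * f2 x + \<phi> x * f3 x" for x
  define F4 where "F4 x = \<phi>4 x * f x + 4 * \<phi>3 x * f1 x + 6 * \<phi>2 x * f2 x + 4 * \<phi>1 x * f3 x + \<phi> x * f4 x" for x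
  have DF: "(F has_real_derivative F1 x) (at x)" "(F1 has_real_derivative F2 x) (at x)"
    "(F2 has_real_derivative F3 x) (at x)" "(F3 has_real_derivative F4 x) (at x)" if "x \<in> V" for x
    using that unfolding F_def F1_def F2_def F3_def F4_def
    by (auto intro!: derivative_eq_intros D simp: algebra_simps)
  have both: "\<phi> u * f2 u = F2 u \<and> \<phi> u * f4 u = F4 u" if u: "u \<in> V" for u
  proof -
    obtain d where d: "d > 0" "{u-d..u+d} \<subseteq> V"
      by (rule interval_nbhd[OF op u])
    have m: "u + t \<in> V" if "\<bar>t\<bar> < d" for t
      by (rule subsetD[OF d(2)]) (use that in auto)
    have e0: "\<phi> u * (f (u + t) + 1 * f (u - t)) = F (u + t) + 1 * F (u - t)" if "\<bar>t\<bar> < d" for t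
    proof -
      have "u + t \<in> V" "u - t \<in> V" using m[OF that] m[of "-t"] that by auto
      then show ?thesis using eq unfolding mid_eq_def F_def by force
    qed
    \<comment> \<open>\<open>e0\<close> is the equation with midpoint \<open>u\<close>; \<open>e1\<close> to \<open>e4\<close> are its derivatives in \<open>t\<close>.\<close>
    note e1 = symmetric_derivative[OF d(1) D(5)[OF m] DF(1)[OF m] e0]
    note e2 = symmetric_derivative[OF d(1) D(6)[OF m] DF(2)[OF m] e1]
    note e3 = symmetric_derivative[OF d(1) D(7)[OF m] DF(3)[OF m] e2]
    note e4 = symmetric_derivative[OF d(1) D(8)[OF m] DF(4)[OF m] e3]
    show ?thesis using e2[of 0] e4[of 0] d(1) by simp
  qed
  \<comment> \<open>The second-order relation, and below its first two derivatives \<open>r3\<close> and \<open>r4\<close>.\<close>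
  have r2: "\<phi>2 u * f u + 2 * \<phi>1 u * f1 u = 0" if "u \<in> V" for u
    using both[OF that] by (simp add: F2_def)
  \<comment> \<open>It says that \<open>\<phi>' f\<^sup>2\<close> is constant; as \<open>\<phi>\<close> is not constant, \<open>\<phi>'\<close> vanishes nowhere.\<close>
  obtain C where C: "\<And>x. x \<in> V \<Longrightarrow> \<phi>1 x * (f x)\<^sup>2 = C"
  proof (rule const_of_zero_deriv[OF iv, of "\<lambda>x. \<phi>1 x * (f x)\<^sup>2"])
    fix x assume x: "x \<in> V"
    have "((\<lambda>x. \<phi>1 x * (f x)\<^sup>2) has_real_derivative f x * (\<phi>2 x * f x + 2 * \<phi>1 x * f1 x)) (at x)"
      using x by (auto intro!: derivative_eq_intros D simp: algebra_simps power2_eq_square)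
    then show "((\<lambda>x. \<phi>1 x * (f x)\<^sup>2) has_real_derivative 0) (at x)" by (simp only: r2[OF x] mult_zero_right)
  qed blast
  obtain x0 where x0: "x0 \<in> V" using ne by auto
  obtain e where e: "e > 0" "{x0-e..x0+e} \<subseteq> V"
    by (rule interval_nbhd[OF op x0])
  have two: "x0 + e \<in> V" "x0 + e \<noteq> x0" using e by auto
  have not_const: "\<not> (\<forall>x\<in>V. \<phi> x = k)" for k
    using inj two x0 by (metis inj_onD)
  have "C \<noteq> 0"
  proof
    assume "C = 0"
    then have "\<phi>1 x = 0" if "x \<in> V" for x using C[OF that] nz[OF that] by simp
    then obtain k where "\<And>x. x \<in> V \<Longrightarrow> \<phi> x = k"
      using const_of_zero_deriv[OF iv, of \<phi>] D(1) by metis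
    then show False using not_const by blast
  qed
  then have p1: "\<phi>1 x \<noteq> 0" if "x \<in> V" for x using C[OF that] by auto
  have zero_deriv: "y = 0" if "(g has_real_derivative y) (at u)" "\<And>x. x \<in> V \<Longrightarrow> g x = 0" "u \<in> V" for g y u
  proof -
    have "\<forall>\<^sub>F r in nhds u. g r = 0"
      using eventually_nhds_in_open[OF op that(3)] by (auto elim!: eventually_mono intro: that(2))
    from DERIV_cong_ev[OF refl this refl] have "((\<lambda>_. 0) has_real_derivative y) (at u)"
      using that(1) by (rule iffD1)
    then show ?thesis by (rule DERIV_unique) simp
  qed
  have r3: "\<phi>3 u * f u + 3 * \<phi>2 u * f1 u + 2 * \<phi>1 u * f2 u = 0" if u: "u \<in> V" for u
  proof -
    have "((\<lambda>u. \<phi>2 u * f u + 2 * \<phi>1 u * f1 u) has_real_derivative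
        \<phi>3 u * f u + 3 * \<phi>2 u * f1 u + 2 * \<phi>1 u * f2 u) (at u)"
      using u by (auto intro!: derivative_eq_intros D simp: algebra_simps)
    from zero_deriv[OF this r2 u] show ?thesis .
  qed
  have r4: "\<phi>4 u * f u + 4 * \<phi>3 u * f1 u + 5 * \<phi>2 u * f2 u + 2 * \<phi>1 u * f3 u = 0" if u: "u \<in> V" for u
  proof -
    have "((\<lambda>u. \<phi>3 u * f u + 3 * \<phi>2 u * f1 u + 2 * \<phi>1 u * f2 u) has_real_derivative
        \<phi>4 u * f u + 4 * \<phi>3 u * f1 u + 5 * \<phi>2 u * f2 u + 2 * \<phi>1 u * f3 u) (at u)"
      using u by (auto intro!: derivative_eq_intros D simp: algebra_simps)
    from zero_deriv[OF this r3 u] show ?thesis .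
  qed
  \<comment> \<open>Subtracting \<open>r4\<close> from the fourth-order relation leaves \<open>\<phi>'' f'' + 2 \<phi>' f''' = 0\<close>.\<close>
  have r: "f3 u * f u - f1 u * f2 u = 0" if u: "u \<in> V" for u
  proof -
    have "\<phi>2 u * f2 u + 2 * \<phi>1 u * f3 u = 0"
      using both[OF u] r4[OF u] by (simp add: F4_def)
    then have "2 * \<phi>1 u * (f3 u * f u - f1 u * f2 u) = 0" using r2[OF u] by algebra
    then show ?thesis using p1[OF u] by simp
  qed
  obtain \<gamma> where \<gamma>: "\<And>x. x \<in> V \<Longrightarrow> f2 x / f x = \<gamma>"
  proof (rule const_of_zero_deriv[OF iv, of "\<lambda>x. f2 x / f x"])
    fix x assume x: "x \<in> V"
    have "((\<lambda>x. f2 x / f x) has_real_derivative (f3 x * f x - f1 x * f2 x) / (f x * f x)) (at x)"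
      using x nz[OF x] by (auto intro!: derivative_eq_intros D simp: algebra_simps)
    then show "((\<lambda>x. f2 x / f x) has_real_derivative 0) (at x)" by (simp add: r[OF x])
  qed blast
  have f2: "f2 x = \<gamma> * f x" if "x \<in> V" for x using \<gamma>[OF that] nz[OF that] by (simp add: field_simps)
  have F2: "F2 x = \<gamma> * F x" if "x \<in> V" for x
    using conjunct1[OF both[OF that]] f2[OF that] by (simp add: F_def) (metis mult.left_commute)
  obtain a b where ab: "\<And>x. x \<in> V \<Longrightarrow> f x = a * basis1 \<gamma> x + b * basis2 \<gamma> x"
    using ode_solution[OF iv D(5), of \<gamma>] D(6) f2 by metis
  obtain c d where cd: "\<And>x. x \<in> V \<Longrightarrow> F x = c * basis1 \<gamma> x + d * basis2 \<gamma> x"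
    using ode_solution[OF iv DF(1), of \<gamma>] DF(2) F2 by metis
  have phi: "\<phi> x = (c * basis1 \<gamma> x + d * basis2 \<gamma> x) / (a * basis1 \<gamma> x + b * basis2 \<gamma> x)" if "x \<in> V" for x
    using ab[OF that] cd[OF that] nz[OF that] by (simp add: F_def field_simps)
  have "a * d \<noteq> b * c"
  proof
    assume dep: "a * d = b * c"
    have aF: "a * F x = c * f x" "b * F x = d * f x" if "x \<in> V" for x
      unfolding ab[OF that] cd[OF that] using dep by algebra+
    have "a \<noteq> 0 \<or> b \<noteq> 0" using nz[OF x0] ab[OF x0] by auto
    then consider "a \<noteq> 0" | "b \<noteq> 0" by blast
    then show False
    proof cases
      case 1
      have "\<phi> x = c / a" if "x \<in> V" for x using aF(1)[OF that] nz[OF that] 1 by (simp add: F_def field_simps)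
      then show False using not_const by blast
    next
      case 2
      have "\<phi> x = d / b" if "x \<in> V" for x using aF(2)[OF that] nz[OF that] 2 by (simp add: F_def field_simps)
      then show False using not_const by blast
    qed
  qed
  then show ?thesis unfolding regular_pair_def using ab phi nz by metis
qed

text \<open>The addition theorems; \<open>k t\<close> is twice a cosine, twice \<open>1\<close>, or twice a hyperbolic cosine.\<close>
lemma basis_average:
  obtains k where "\<And>u t. basis1 \<gamma> (u + t) + basis1 \<gamma> (u - t) = k t * basis1 \<gamma> u"
    "\<And>u t. basis2 \<gamma> (u + t) + basis2 \<gamma> (u - t) = k t * basis2 \<gamma> u"
proof
  let ?k = "\<lambda>t. if \<gamma> < 0 then 2 * cos (sqrt (- \<gamma>) * t) else if \<gamma> = 0 then 2 else 2 * cosh (sqrt \<gamma> * t)"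
  show "basis1 \<gamma> (u + t) + basis1 \<gamma> (u - t) = ?k t * basis1 \<gamma> u" for u t
    by (simp add: basis1_def distrib_left right_diff_distrib sin_add sin_diff sinh_add sinh_diff)
  show "basis2 \<gamma> (u + t) + basis2 \<gamma> (u - t) = ?k t * basis2 \<gamma> u" for u t
    by (simp add: basis2_def distrib_left right_diff_distrib cos_add cos_diff cosh_add cosh_diff)
qed

lemma regular_imp_mid_eq:
  assumes reg: "regular_pair V \<phi> f" and iv: "is_interval V"
  shows "mid_eq V \<phi> f"
  unfolding mid_eq_def
proof (intro ballI)
  fix x y assume x: "x \<in> V" and y: "y \<in> V"
  obtain a b c d \<gamma> where f: "\<And>x. x \<in> V \<Longrightarrow> f x = a * basis1 \<gamma> x + b * basis2 \<gamma> x"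
    and nz: "\<And>x. x \<in> V \<Longrightarrow> f x \<noteq> 0"
    and phi: "\<And>x. x \<in> V \<Longrightarrow> \<phi> x = (c * basis1 \<gamma> x + d * basis2 \<gamma> x) / (a * basis1 \<gamma> x + b * basis2 \<gamma> x)"
    using reg unfolding regular_pair_def by blast
  have F: "\<phi> x * f x = c * basis1 \<gamma> x + d * basis2 \<gamma> x" if "x \<in> V" for x
    using phi[OF that] f[OF that] nz[OF that] by simp
  obtain k where k: "\<And>u t. basis1 \<gamma> (u + t) + basis1 \<gamma> (u - t) = k t * basis1 \<gamma> u"
    "\<And>u t. basis2 \<gamma> (u + t) + basis2 \<gamma> (u - t) = k t * basis2 \<gamma> u"
    using basis_average by blast
  define u t where "u = (x + y) / 2" and "t = (x - y) / 2"
  have xy: "x = u + t" "y = u - t" by (auto simp: u_def t_def field_simps)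
  have u: "u \<in> V" unfolding u_def by (rule midpoint_mem[OF iv x y])
  have "f x + f y = k t * f u"
    unfolding f[OF x] f[OF y] f[OF u] unfolding xy using k[of u t] by algebra
  moreover have "\<phi> x * f x + \<phi> y * f y = k t * (\<phi> u * f u)"
    unfolding F[OF x] F[OF y] F[OF u] unfolding xy using k[of u t] by algebra
  ultimately show "\<phi> ((x + y) / 2) * (f x + f y) = \<phi> x * f x + \<phi> y * f y"
    by (simp add: u_def)
qed

section \<open>From intervals without zeros to the whole interval\<close>

lemma rel_closure_eq: "S \<subseteq> I \<Longrightarrow> rel_closure I S = I \<inter> closure S"
  unfolding rel_closure_def by (simp add: closure_of_subtopology inf.absorb2)

lemma continuous_closure_value:
  fixes g :: "real \<Rightarrow> real"
  assumes "continuous_on I g" "S \<subseteq> I" "q \<in> I" "q \<in> closure S" "\<And>s. s \<in> S \<Longrightarrow> g s = c"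
  shows "g q = c"
proof -
  obtain s where s: "\<And>n. s n \<in> S" "s \<longlonglongrightarrow> q" using assms(4) closure_sequential by blast
  have "(\<lambda>n. g (s n)) \<longlonglongrightarrow> g q"
    by (rule continuous_on_tendsto_compose[OF assms(1) s(2) assms(3)]) (use s(1) assms(2) in \<open>blast intro: always_eventually\<close>)
  then show ?thesis using s(1) assms(5) by (simp add: LIMSEQ_const_iff)
qed

text \<open>
  A boundary point \<open>q \<in> I\<close> of the component \<open>V\<close> would be a limit of zeros of \<open>f\<close>. But for \<open>y\<close> near \<open>q\<close> the midpoint
  of \<open>x0\<close> and \<open>y\<close> still lies in \<open>V\<close>, where \<open>\<phi>\<close> differs from \<open>\<phi> x0\<close>, so \<open>f y \<noteq> 0\<close>.
\<close>
lemma injective_component_full: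
  assumes eq: "mid_eq I \<phi> f" and op: "open I" and iv: "is_interval I"
    and x0: "x0 \<in> I - closure (zero_set I f)"
    and V_def: "V = connected_component_set (I - closure (zero_set I f)) x0"
    and inj: "inj_on \<phi> V"
  shows "V = I"
proof (rule ccontr)
  assume VI: "V \<noteq> I"
  define U where "U = I - closure (zero_set I f)"
  have VU: "V \<subseteq> U" "x0 \<in> V" unfolding V_def U_def
    using connected_component_subset x0 by (auto simp: connected_component_refl)
  have oV: "open V" unfolding V_def using op by (intro open_connected_component open_Diff) auto
  have cV: "connected V" unfolding V_def by simp
  then have iV: "is_interval V" by (simp add: is_interval_connected_1)
  have UI: "U \<subseteq> I" by (auto simp: U_def)
  have "\<not> I \<inter> closure V \<subseteq> V"
  proof
    assume "I \<inter> closure V \<subseteq> V"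
    then have "V = I \<inter> closure V" using VU UI closure_subset by blast
    then have "closedin (top_of_set I) V" using closedin_closed by blast
    moreover have "openin (top_of_set I) V" using oV VU UI by (simp add: open_subset)
    ultimately show False using iv VU(2) VI unfolding is_interval_connected_1 connected_clopen by blast
  qed
  then obtain q where q: "q \<in> I" "q \<in> closure V" "q \<notin> V" by auto
  have mV: "(x0 + q) / 2 \<in> V"
  proof -
    have ne: "x0 \<noteq> q" using q VU by auto
    then obtain v where v: "v \<in> V" "dist v q < \<bar>x0 - q\<bar> / 2"
      using q(2) unfolding closure_approachable by (metis abs_ge_zero half_gt_zero less_eq_real_def right_minus_eq abs_eq_0)
    show ?thesis
    proof (cases "x0 < q")
      case True
      show ?thesis by (rule mem_is_interval_1_I[OF iV VU(2) v(1)]) (use True v(2) in \<open>auto simp: dist_real_def abs_real_def split: if_splits\<close>)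
    next
      case False
      show ?thesis by (rule mem_is_interval_1_I[OF iV v(1) VU(2)]) (use False v(2) in \<open>auto simp: dist_real_def abs_real_def split: if_splits\<close>)
    qed
  qed
  define N where "N = (\<lambda>y. (x0 + y) / 2) -` V \<inter> - {x0}"
  have "open N" unfolding N_def by (intro open_Int open_vimage oV continuous_intros) auto
  have "f y \<noteq> 0" if "y \<in> I" "y \<in> N" for y
  proof
    assume "f y = 0"
    have "f x0 * (\<phi> ((x0 + y) / 2) - \<phi> x0) = 0"
      using mid_eqD[OF eq _ that(1), of x0] x0 \<open>f y = 0\<close> by simp
    moreover have "f x0 \<noteq> 0" using x0 closure_subset[of "zero_set I f"] by (auto simp: zero_set_def)
    ultimately have "\<phi> ((x0 + y) / 2) = \<phi> x0" by simp
    then have "(x0 + y) / 2 = x0" using inj_onD[OF inj, of "(x0 + y) / 2" x0] VU(2) that(2) by (simp add: N_def)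
    then show False using that(2) by (simp add: N_def)
  qed
  then have "N \<inter> zero_set I f = {}" by (auto simp: zero_set_def)
  then have "N \<inter> closure (zero_set I f) = {}" using open_Int_closure_eq_empty[OF \<open>open N\<close>] by blast
  moreover have "q \<in> N" using mV q VU by (auto simp: N_def)
  ultimately have "q \<in> U" using q by (auto simp: U_def)
  have "connected (insert q V)"
    by (rule connected_intermediate_closure[OF cV]) (use q closure_subset in auto)
  then have "insert q V \<subseteq> connected_component_set U x0"
    using VU \<open>q \<in> U\<close> by (intro connected_component_maximal) auto
  then show False using q(3) unfolding V_def U_def by auto
qed

text \<open>
  The hypothesis \<open>loc\<close> says that \<open>\<phi>\<close> is constant on each component of \<open>U\<close>.
\<close>
lemma locally_constant_imp_degenerate:
  assumes eq: "mid_eq I \<phi> f" and iv: "is_interval I"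
    and cont: "continuous_on I \<phi>"
    and U_def: "U = I - closure (zero_set I f)" and ne: "U \<noteq> {}"
    and supp: "I - zero_set I f \<subseteq> closure (convex hull U)"
    and loc: "\<And>s t. s \<le> t \<Longrightarrow> {s..t} \<subseteq> U \<Longrightarrow> \<phi> s = \<phi> t"
  shows "\<exists>c. \<forall>x \<in> I \<inter> closure (convex hull U). \<forall>y\<in>I. \<phi> ((x + y) / 2) = c"
proof -
  define Z where "Z = zero_set I f"
  have ZI: "Z \<subseteq> I" by (auto simp: Z_def zero_set_def)
  have UI: "U \<subseteq> I" by (auto simp: U_def)
  have UZ: "x \<in> U \<or> x \<in> closure Z" if "x \<in> I" for x using that by (auto simp: U_def Z_def)
  have fU: "f x \<noteq> 0" if "x \<in> U" for x
    using that closure_subset[of "zero_set I f"] by (auto simp: U_def zero_set_def)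
  have Iab: "{a..b} \<subseteq> I" if "a \<in> I" "b \<in> I" for a b
    using mem_is_interval_1_I[OF iv that] by auto
  have cmid: "continuous_on I (\<lambda>t. \<phi> ((t + y) / 2))" "continuous_on I (\<lambda>t. \<phi> ((y + t) / 2))" if "y \<in> I" for y
    using that by (auto intro!: continuous_on_compose2[OF cont] continuous_intros midpoint_mem[OF iv])
  have H: "\<phi> ((x + y) / 2) = \<phi> x" if x: "x \<in> U" and y: "y \<in> I" "y \<in> closure Z" for x y
  proof (rule continuous_closure_value[OF cmid(2) ZI y])
    show "x \<in> I" using x UI by auto
    fix z assume z: "z \<in> Z"
    then have "f x * (\<phi> ((x + z) / 2) - \<phi> x) = 0"
      using mid_eqD[OF eq, of x z] x UI by (auto simp: Z_def zero_set_def)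
    then show "\<phi> ((x + z) / 2) = \<phi> x" using fU[OF x] by simp
  qed
  \<comment> \<open>Let \<open>q\<close> be the first and \<open>p\<close> the last point of \<open>{u..v}\<close> outside \<open>U\<close>. By \<open>H\<close> and continuity, the value at
    the midpoint of \<open>q\<close> and \<open>p\<close> is both \<open>\<phi> u\<close> and \<open>\<phi> v\<close>.\<close>
  have same: "\<phi> u = \<phi> v" if uv: "u \<in> U" "v \<in> U" "u < v" for u v
  proof (cases "{u..v} \<subseteq> U")
    case True
    then show ?thesis using loc uv by simp
  next
    case False
    define A where "A = closure Z \<inter> {u..v}"
    have AI: "{u..v} \<subseteq> I" using Iab uv UI by blast
    have "compact A" unfolding A_def by (simp add: closed_Int_compact)
    moreover have "A \<noteq> {}" using False AI UZ by (auto simp: A_def)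
    ultimately obtain q p where q: "q \<in> A" "\<And>t. t \<in> A \<Longrightarrow> q \<le> t" and p: "p \<in> A" "\<And>t. t \<in> A \<Longrightarrow> t \<le> p"
      using compact_attains_inf compact_attains_sup by metis
    have nUZ: "t \<notin> closure Z" if "t \<in> U" for t using that by (auto simp: U_def Z_def)
    have qp: "u < q" "p < v" "q \<in> I" "p \<in> I" "q \<in> closure Z" "p \<in> closure Z"
      using q(1) p(1) nUZ[OF uv(1)] nUZ[OF uv(2)] AI by (auto simp: A_def order.order_iff_strict)
    have inA: "t \<in> U \<or> t \<in> A" if "t \<in> {u..v}" for t
      using UZ[of t] AI that by (auto simp: A_def)
    have quv: "q \<le> v" "u \<le> p" using q(1) p(1) by (auto simp: A_def)
    have l: "{u..<q} \<subseteq> U"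
    proof
      fix t assume "t \<in> {u..<q}"
      then show "t \<in> U" using inA[of t] q(2)[of t] quv by auto
    qed
    have r: "{p<..v} \<subseteq> U"
    proof
      fix t assume "t \<in> {p<..v}"
      then show "t \<in> U" using inA[of t] p(2)[of t] quv by auto
    qed
    have "\<phi> ((q + p) / 2) = \<phi> u"
    proof (rule continuous_closure_value[OF cmid(1)[OF qp(4)]])
      show "{u..<q} \<subseteq> I" using l UI by blast
      show "q \<in> closure {u..<q}" using qp by simp
      fix t assume t: "t \<in> {u..<q}"
      then have "\<phi> u = \<phi> t" using l by (intro loc) auto
      then show "\<phi> ((t + p) / 2) = \<phi> u" using H[of t p] t l qp by auto
    qed fact
    moreover have "\<phi> ((p + q) / 2) = \<phi> v"
    proof (rule continuous_closure_value[OF cmid(1)[OF qp(3)]])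
      show "{p<..v} \<subseteq> I" using r UI by blast
      show "p \<in> closure {p<..v}" using qp by simp
      fix t assume t: "t \<in> {p<..v}"
      then have "\<phi> t = \<phi> v" using r by (intro loc) auto
      then show "\<phi> ((t + q) / 2) = \<phi> v" using H[of t q] t r qp by auto
    qed fact
    ultimately show ?thesis by (simp add: add.commute)
  qed
  obtain u0 where u0: "u0 \<in> U" using ne by auto
  define c where "c = \<phi> u0"
  have cU: "\<phi> u = c" if "u \<in> U" for u
    unfolding c_def using same that u0 by (metis linorder_neqE_linordered_idom)
  have HC: "\<phi> ((x + y) / 2) = c" if x: "x \<in> I" "x \<in> closure U" and y: "y \<in> I" "y \<in> closure Z" for x y
    by (rule continuous_closure_value[OF cmid(1)[OF y(1)] UI x]) (use H[OF _ y] cU in auto)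
  have hI: "convex hull U \<subseteq> I"
    using UI iv by (simp add: subset_hull is_interval_convex)
  have hull: "\<phi> m = c" if m: "m \<in> convex hull U" for m
  proof (cases "m \<in> closure U")
    case True
    show ?thesis by (rule continuous_closure_value[OF cont UI _ True cU]) (use m hI in auto)
  next
    case False
    \<comment> \<open>\<open>m\<close> lies in a gap \<open>(r0, s0)\<close> of \<open>U\<close>, which is contained in the closure of the zeros. Hence \<open>m\<close> is the
      midpoint of the nearer end of the gap and a point of that closure.\<close>
    have "\<not> U \<subseteq> {..<m}" "\<not> U \<subseteq> {m<..}"
      using m hull_minimal[of U "{..<m}" convex] hull_minimal[of U "{m<..}" convex] by auto
    then obtain r1 s1 where rs1: "r1 \<in> U" "r1 \<le> m" "s1 \<in> U" "m \<le> s1"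
      by (metis greaterThan_iff lessThan_iff not_less subsetI)
    have "compact (closure U \<inter> {m..s1})" "closure U \<inter> {m..s1} \<noteq> {}"
      using rs1 closure_subset[of U] by (auto simp: closed_Int_compact)
    then obtain s0 where s0: "s0 \<in> closure U \<inter> {m..s1}" "\<And>t. t \<in> closure U \<inter> {m..s1} \<Longrightarrow> s0 \<le> t"
      using compact_attains_inf by metis
    have "compact (closure U \<inter> {r1..m})" "closure U \<inter> {r1..m} \<noteq> {}"
      using rs1 closure_subset[of U] by (auto simp: closed_Int_compact)
    then obtain r0 where r0: "r0 \<in> closure U \<inter> {r1..m}" "\<And>t. t \<in> closure U \<inter> {r1..m} \<Longrightarrow> t \<le> r0"
      using compact_attains_sup by metis
    have rI: "{r1..s1} \<subseteq> I" using Iab rs1 UI by blast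
    have lt: "r0 < m" "m < s0" using r0(1) s0(1) False by (auto simp: order.order_iff_strict)
    have mem: "r0 \<in> I" "s0 \<in> I" using r0(1) s0(1) rI lt by auto
    have "{r0<..<s0} \<subseteq> closure Z"
    proof
      fix t assume t: "t \<in> {r0<..<s0}"
      have "t \<in> I" using Iab[OF mem] t by auto
      moreover have "t \<notin> U"
      proof
        assume "t \<in> U"
        then have "t \<in> closure U" using closure_subset by blast
        then show False using t r0 s0 by (cases "t \<le> m") fastforce+
      qed
      ultimately show "t \<in> closure Z" using UZ by blast
    qed
    then have "closure {r0<..<s0} \<subseteq> closure Z" by (simp add: closure_minimal)
    then have gap: "{r0..s0} \<subseteq> closure Z" using lt by simp
    show ?thesis
    proof (cases "m \<le> (r0 + s0) / 2")
      case True
      have y: "2 * m - r0 \<in> {r0..s0}" using True lt by auto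
      have "\<phi> ((r0 + (2 * m - r0)) / 2) = c"
        by (rule HC) (use mem r0(1) y gap Iab[OF mem] in auto)
      then show ?thesis by simp
    next
      case False
      have y: "2 * m - s0 \<in> {r0..s0}" using False lt by auto
      have "\<phi> ((s0 + (2 * m - s0)) / 2) = c"
        by (rule HC) (use mem s0(1) y gap Iab[OF mem] in auto)
      then show ?thesis by simp
    qed
  qed
  define J where "J = I \<inter> closure (convex hull U)"
  have iJ: "is_interval J" unfolding J_def
    using iv by (intro is_interval_Int) (auto simp: is_interval_convex_1 convex_closure)
  have cJ: "\<phi> m = c" if "m \<in> J" for m
    by (rule continuous_closure_value[OF cont hI _ _ hull]) (use that in \<open>auto simp: J_def\<close>)
  have UJ: "U \<subseteq> J" using UI hull_subset[of U convex] closure_subset[of "convex hull U"] by (auto simp: J_def)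
  have clUJ: "x \<in> J" if "x \<in> closure U" "x \<in> I" for x
    using that closure_mono[OF hull_subset[of U convex]] by (auto simp: J_def)
  have offJ: "x \<in> closure Z" if "x \<in> I" "x \<notin> J" for x
    using that supp closure_subset[of Z] by (auto simp: J_def Z_def)
  have "\<phi> ((x + y) / 2) = c" if x: "x \<in> J" and y: "y \<in> I" for x y
  proof (cases "(x + y) / 2 \<in> J")
    case True
    then show ?thesis by (rule cJ)
  next
    case False
    define m where "m = (x + y) / 2"
    have xI: "x \<in> I" using x by (simp add: J_def)
    have m2: "x + y = 2 * m" by (simp add: m_def)
    have mI: "m \<in> I" unfolding m_def by (rule midpoint_mem[OF iv xI y])
    have mJ: "m \<notin> J" using False by (simp add: m_def)
    \<comment> \<open>Outside \<open>J\<close>, \<open>m\<close> is rewritten as the midpoint of the end \<open>k\<close> of \<open>U\<close> facing it and a zero of \<open>f\<close>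
      beyond \<open>m\<close>, so that \<open>HC\<close> applies.\<close>
    have "x \<noteq> m" using x mJ by auto
    then consider "x < m" | "m < x" by linarith
    then have "\<exists>k y'. k \<in> I \<and> k \<in> closure U \<and> y' \<in> I \<and> y' \<in> closure Z \<and> (k + y') / 2 = m"
    proof cases
      case 1
      have less: "j < m" if "j \<in> J" for j
        by (rule ccontr) (use mem_is_interval_1_I[OF iJ x that, of m] mJ 1 in \<open>auto simp: not_less\<close>)
      define k where "k = Sup U"
      have bdd: "bdd_above U" using UJ less by (intro bdd_aboveI[of _ m]) force
      have kU: "k \<in> closure U" unfolding k_def by (rule closure_contains_Sup[OF ne bdd])
      have km: "k \<le> m" unfolding k_def using UJ less by (intro cSup_least ne) force
      have uk: "u0 \<le> k" unfolding k_def by (rule cSup_upper[OF u0 bdd])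
      have kI: "k \<in> I" using subsetD[OF Iab[OF _ mI], of u0 k] u0 UI uk km by auto
      have "k < m" using less[OF clUJ[OF kU kI]] .
      have "convex hull U \<subseteq> {..k}"
        by (rule hull_minimal) (auto simp: k_def intro: cSup_upper bdd)
      then have "closure (convex hull U) \<subseteq> {..k}" by (simp add: closure_minimal)
      then have "x \<le> k" using x by (auto simp: J_def)
      have "2 * m - k \<in> {m..y}" using \<open>k < m\<close> \<open>x \<le> k\<close> m2 by auto
      then have y'I: "2 * m - k \<in> I" using Iab[OF mI y] by blast
      moreover have "2 * m - k \<notin> J" using less[of "2 * m - k"] \<open>k < m\<close> by auto
      ultimately have "2 * m - k \<in> closure Z" by (rule offJ)
      then show ?thesis using kI kU y'I by (intro exI[of _ k] exI[of _ "2 * m - k"]) auto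
    next
      case 2
      have less: "m < j" if "j \<in> J" for j
        by (rule ccontr) (use mem_is_interval_1_I[OF iJ that x, of m] mJ 2 in \<open>auto simp: not_less\<close>)
      define k where "k = Inf U"
      have bdd: "bdd_below U" using UJ less by (intro bdd_belowI[of _ m]) force
      have kU: "k \<in> closure U" unfolding k_def by (rule closure_contains_Inf[OF ne bdd])
      have km: "m \<le> k" unfolding k_def using UJ less by (intro cInf_greatest ne) force
      have uk: "k \<le> u0" unfolding k_def by (rule cInf_lower[OF u0 bdd])
      have kI: "k \<in> I" using subsetD[OF Iab[OF mI], of u0 k] u0 UI uk km by auto
      have "m < k" using less[OF clUJ[OF kU kI]] .
      have "convex hull U \<subseteq> {k..}"
        by (rule hull_minimal) (auto simp: k_def intro: cInf_lower bdd)
      then have "closure (convex hull U) \<subseteq> {k..}" by (simp add: closure_minimal)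
      then have "k \<le> x" using x by (auto simp: J_def)
      have "2 * m - k \<in> {y..m}" using \<open>m < k\<close> \<open>k \<le> x\<close> m2 by auto
      then have y'I: "2 * m - k \<in> I" using Iab[OF y mI] by blast
      moreover have "2 * m - k \<notin> J" using less[of "2 * m - k"] \<open>m < k\<close> by auto
      ultimately have "2 * m - k \<in> closure Z" by (rule offJ)
      then show ?thesis using kI kU y'I by (intro exI[of _ k] exI[of _ "2 * m - k"]) auto
    qed
    then obtain k y' where k: "k \<in> I" "k \<in> closure U" "y' \<in> I" "y' \<in> closure Z" "(k + y') / 2 = m" by blast
    show ?thesis using HC[OF k(1-4)] k(5) by (simp add: m_def)
  qed
  then show ?thesis unfolding J_def by blast
qed

lemma degenerate_imp_mid_eq:
  assumes z: "\<And>x. x \<in> I - J \<Longrightarrow> f x = 0" and JI: "J \<subseteq> I"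
    and c: "\<And>x y. x \<in> J \<Longrightarrow> y \<in> I \<Longrightarrow> \<phi> ((x + y) / 2) = c"
  shows "mid_eq I \<phi> f"
  unfolding mid_eq_def
proof (intro ballI)
  fix x y assume x: "x \<in> I" and y: "y \<in> I"
  have cJ: "\<phi> t = c" if "t \<in> J" for t using c[of t t] that JI by auto
  have F: "\<phi> t * f t = c * f t" if "t \<in> I" for t using cJ[of t] z[of t] that by auto
  have "\<phi> ((x + y) / 2) * (f x + f y) = c * (f x + f y)"
  proof (cases "x \<in> J \<or> y \<in> J")
    case True
    then have "\<phi> ((x + y) / 2) = c" using c[of x y] c[of y x] x y by (auto simp: add.commute)
    then show ?thesis by simp
  qed (use x y z in auto)
  then show "\<phi> ((x + y) / 2) * (f x + f y) = \<phi> x * f x + \<phi> y * f y"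
    by (simp add: F[OF x] F[OF y] distrib_left)
qed

lemma half_sum_constant:
  fixes \<phi> :: "real \<Rightarrow> real"
  shows "\<phi> constant_on ((\<lambda>t. (1/2) * t) ` (J + I)) \<longleftrightarrow> (\<exists>c. \<forall>x\<in>J. \<forall>y\<in>I. \<phi> ((x + y) / 2) = c)"
proof -
  have "(\<exists>c. \<forall>t\<in>(\<lambda>t. (1/2) * t) ` (J + I). \<phi> t = c) \<longleftrightarrow>
      (\<exists>c. \<forall>x\<in>J. \<forall>y\<in>I. \<phi> ((1/2) * (x + y)) = c)"
    unfolding set_plus_def by blast
  then show ?thesis unfolding constant_on_def by simp
qed

lemma regular_pair_iff:
  "regular_pair I \<phi> f \<longleftrightarrow> (\<exists>a b c d \<gamma> :: real. a * d \<noteq> b * c \<and>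
        (\<forall>x\<in>I.
          (\<gamma> < 0 \<longrightarrow>
             f x = a * sin (sqrt (- \<gamma>) * x) + b * cos (sqrt (- \<gamma>) * x) \<and> f x \<noteq> 0 \<and>
             \<phi> x = (c * sin (sqrt (- \<gamma>) * x) + d * cos (sqrt (- \<gamma>) * x)) /
                   (a * sin (sqrt (- \<gamma>) * x) + b * cos (sqrt (- \<gamma>) * x))) \<and>
          (\<gamma> = 0 \<longrightarrow>
             f x = a + b * x \<and> f x \<noteq> 0 \<and>
             \<phi> x = (c + d * x) / (a + b * x)) \<and>
          (\<gamma> > 0 \<longrightarrow>
             f x = a * sinh (sqrt \<gamma> * x) + b * cosh (sqrt \<gamma> * x) \<and> f x \<noteq> 0 \<and>
             \<phi> x = (c * sinh (sqrt \<gamma> * x) + d * cosh (sqrt \<gamma> * x)) /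
                   (a * sinh (sqrt \<gamma> * x) + b * cosh (sqrt \<gamma> * x)))))"
proof -
  have *: "(f x = a * basis1 \<gamma> x + b * basis2 \<gamma> x \<and> f x \<noteq> 0 \<and>
       \<phi> x = (c * basis1 \<gamma> x + d * basis2 \<gamma> x) / (a * basis1 \<gamma> x + b * basis2 \<gamma> x)) \<longleftrightarrow>
     (\<gamma> < 0 \<longrightarrow>
             f x = a * sin (sqrt (- \<gamma>) * x) + b * cos (sqrt (- \<gamma>) * x) \<and> f x \<noteq> 0 \<and>
             \<phi> x = (c * sin (sqrt (- \<gamma>) * x) + d * cos (sqrt (- \<gamma>) * x)) /
                   (a * sin (sqrt (- \<gamma>) * x) + b * cos (sqrt (- \<gamma>) * x))) \<and>
          (\<gamma> = 0 \<longrightarrow>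
             f x = a + b * x \<and> f x \<noteq> 0 \<and>
             \<phi> x = (c + d * x) / (a + b * x)) \<and>
          (\<gamma> > 0 \<longrightarrow>
             f x = a * sinh (sqrt \<gamma> * x) + b * cosh (sqrt \<gamma> * x) \<and> f x \<noteq> 0 \<and>
             \<phi> x = (c * sinh (sqrt \<gamma> * x) + d * cosh (sqrt \<gamma> * x)) /
                   (a * sinh (sqrt \<gamma> * x) + b * cosh (sqrt \<gamma> * x)))" for a b c d \<gamma> x
    by (cases \<gamma> "0::real" rule: linorder_cases) (simp_all add: basis1_def basis2_def)
  show ?thesis unfolding regular_pair_def * ..
qed

section \<open>The characterization\<close>

theorem theorem11:
  fixes I :: "real set" and \<phi> f :: "real \<Rightarrow> real"
  assumes "I \<noteq> {}" and "open I" and "is_interval I"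
    and "continuous_on I \<phi>"
    and "I - zero_set I f \<subseteq> rel_closure I (convex hull (I - rel_closure I (zero_set I f)))"
  shows "(\<forall>x\<in>I. \<forall>y\<in>I. \<phi> ((x + y) / 2) * (f x + f y) = \<phi> x * f x + \<phi> y * f y) \<longleftrightarrow>
    (\<exists>J. is_interval J \<and> J \<subseteq> I \<and> (\<forall>x \<in> I - J. f x = 0) \<and>
         \<phi> constant_on ((\<lambda>t. (1/2) * t) ` (J + I)))
    \<or> (\<exists>a b c d \<gamma> :: real. a * d \<noteq> b * c \<and>
        (\<forall>x\<in>I.
          (\<gamma> < 0 \<longrightarrow>
             f x = a * sin (sqrt (- \<gamma>) * x) + b * cos (sqrt (- \<gamma>) * x) \<and> f x \<noteq> 0 \<and>
             \<phi> x = (c * sin (sqrt (- \<gamma>) * x) + d * cos (sqrt (- \<gamma>) * x)) /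
                   (a * sin (sqrt (- \<gamma>) * x) + b * cos (sqrt (- \<gamma>) * x))) \<and>
          (\<gamma> = 0 \<longrightarrow>
             f x = a + b * x \<and> f x \<noteq> 0 \<and>
             \<phi> x = (c + d * x) / (a + b * x)) \<and>
          (\<gamma> > 0 \<longrightarrow>
             f x = a * sinh (sqrt \<gamma> * x) + b * cosh (sqrt \<gamma> * x) \<and> f x \<noteq> 0 \<and>
             \<phi> x = (c * sinh (sqrt \<gamma> * x) + d * cosh (sqrt \<gamma> * x)) /
                   (a * sinh (sqrt \<gamma> * x) + b * cosh (sqrt \<gamma> * x)))))"
  unfolding regular_pair_iff[symmetric] mid_eq_def[symmetric] half_sum_constant
proof
  define U where "U = I - closure (zero_set I f)"
  have "rel_closure I (zero_set I f) = I \<inter> closure (zero_set I f)"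
    by (rule rel_closure_eq) (auto simp: zero_set_def)
  then have U: "I - rel_closure I (zero_set I f) = U" by (auto simp: U_def)
  have UI: "U \<subseteq> I" by (auto simp: U_def)
  have hI: "convex hull U \<subseteq> I"
    using UI assms(3) by (simp add: subset_hull is_interval_convex)
  have supp: "I - zero_set I f \<subseteq> I \<inter> closure (convex hull U)"
    using assms(5) unfolding U rel_closure_eq[OF hI] .
  assume eq: "mid_eq I \<phi> f"
  show "(\<exists>J. is_interval J \<and> J \<subseteq> I \<and> (\<forall>x\<in>I - J. f x = 0) \<and>
      (\<exists>c. \<forall>x\<in>J. \<forall>y\<in>I. \<phi> ((x + y) / 2) = c)) \<or> regular_pair I \<phi> f"
  proof (cases "\<exists>x0\<in>U. inj_on \<phi> (connected_component_set U x0)")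
    case True
    then obtain x0 where x0: "x0 \<in> U" "inj_on \<phi> (connected_component_set U x0)" by blast
    then have full: "connected_component_set U x0 = I"
      using injective_component_full[OF eq assms(2,3)] unfolding U_def by blast
    then have "I \<subseteq> U" using connected_component_subset by blast
    then have "f x \<noteq> 0" if "x \<in> I" for x
      using that closure_subset[of "zero_set I f"] by (auto simp: U_def zero_set_def)
    then have "regular_pair I \<phi> f"
      using injective_imp_regular[OF eq assms(3,2,1)] x0(2) assms(4) unfolding full by blast
    then show ?thesis ..
  next
    case False
    have loc: "\<phi> s = \<phi> t" if st: "s \<le> t" "{s..t} \<subseteq> U" for s t
    proof -
      define V where "V = connected_component_set U s"
      have VU: "V \<subseteq> U" unfolding V_def by (rule connected_component_subset)
      have "{s..t} \<subseteq> V" unfolding V_def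
        by (rule connected_component_maximal) (use st in auto)
      then have sV: "s \<in> V" "t \<in> V" using st by auto
      have nz: "f x \<noteq> 0" if "x \<in> V" for x
        using that VU closure_subset[of "zero_set I f"] by (auto simp: U_def zero_set_def)
      have "is_interval V" unfolding V_def by (simp add: is_interval_connected_1)
      then have "\<phi> constant_on V \<or> inj_on \<phi> V"
        using VU UI nz
        by (intro constant_or_injective[OF mid_eq_subset[OF eq] _ continuous_on_subset[OF assms(4)]]) auto
      moreover have "\<not> inj_on \<phi> V" using False sV VU unfolding V_def by blast
      ultimately show ?thesis using sV unfolding constant_on_def by auto
    qed
    show ?thesis
    proof (cases "U = {}")
      case True
      then have "I - zero_set I f \<subseteq> {}" using supp by simp
      then have "\<forall>x\<in>I - {}. f x = 0" by (auto simp: zero_set_def)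
      then show ?thesis by (intro disjI1 exI[of _ "{}"]) auto
    next
      case ne: False
      have "\<exists>c. \<forall>x \<in> I \<inter> closure (convex hull U). \<forall>y\<in>I. \<phi> ((x + y) / 2) = c"
        using locally_constant_imp_degenerate[OF eq assms(3,4) U_def ne _ loc] supp by blast
      moreover have "is_interval (I \<inter> closure (convex hull U))"
        using assms(3) by (intro is_interval_Int) (auto simp: is_interval_convex_1 convex_closure)
      moreover have "\<forall>x\<in>I - I \<inter> closure (convex hull U). f x = 0"
        using supp by (auto simp: zero_set_def)
      ultimately show ?thesis by (intro disjI1 exI[of _ "I \<inter> closure (convex hull U)"]) auto
    qed
  qed
next
  assume "(\<exists>J. is_interval J \<and> J \<subseteq> I \<and> (\<forall>x\<in>I - J. f x = 0) \<and>
      (\<exists>c. \<forall>x\<in>J. \<forall>y\<in>I. \<phi> ((x + y) / 2) = c)) \<or> regular_pair I \<phi> f"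
  then show "mid_eq I \<phi> f"
  proof
    assume "\<exists>J. is_interval J \<and> J \<subseteq> I \<and> (\<forall>x\<in>I - J. f x = 0) \<and>
      (\<exists>c. \<forall>x\<in>J. \<forall>y\<in>I. \<phi> ((x + y) / 2) = c)"
    then obtain J c where "J \<subseteq> I" "\<forall>x\<in>I - J. f x = 0" "\<forall>x\<in>J. \<forall>y\<in>I. \<phi> ((x + y) / 2) = c" by blast
    then show ?thesis by (intro degenerate_imp_mid_eq[of I J f \<phi> c]) auto
  next
    assume "regular_pair I \<phi> f"
    then show ?thesis using regular_imp_mid_eq assms(3) by blast
  qed
qed

end
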